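(* Let $(a_1,a_2)\in E$ and let $X$ be the AR(2)-process with coefficients $a_1,a_2$. Assume that $\mathbb{P}(Y_1>0)\in(0,1)$, $\mathbb{E}[e^{|Y_1|^\alpha}]<\infty$ for some $\alpha>0$, and that the characteristic function $\varphi$ of $Y_1$ satisfies $\varphi(t)\to0$ as $|t|\to\infty$. Then there is $\lambda=\lambda(a_1,a_2)>0$ such that $p_N\precsim \exp(-\lambda N/\log N)$ as $N\to\infty$.
   Context: Let $(Y_n)_{n\ge1}$ be i.i.d. nondegenerate real random variables. The AR(2)-process is $X_n=a_1X_{n-1}+a_2X_{n-2}+Y_n$ for $n\ge1$ with $X_n=0$ for $n\le0$; $p_N:=\mathbb{P}(\sup_{n=1,\dots,N}X_n\le0)$. Define the regions $C:=\{a_1\ge2,\ a_1^2+4a_2>0\}\cup\{a_1\in(0,2),\ a_1+a_2>1\}\cup\{a_1^2+4a_2=0,\ a_1>2\}\cup\{a_1=0,\ a_2>1\}$, $P:=\{a_1+a_2=1,\ a_2\in[-1,1]\}$, and $E:=\mathbb{R}^2\setminus(C\cup P)$. $f\precsim g$ means $\limsup f/g<\infty$. *)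

theory Defs
  imports "HOL-Probability.Probability" "HOL-Library.Landau_Symbols"
begin

text \<open>AR(2)-process X_n = a1 X_(n-1) + a2 X_(n-2) + Y_n for n >= 1, X_n = 0 for n <= 0.
  Only indices n >= 1 of the innovation sequence Y are used.\<close>
fun ar2 :: "real \<Rightarrow> real \<Rightarrow> (nat \<Rightarrow> 'a \<Rightarrow> real) \<Rightarrow> nat \<Rightarrow> 'a \<Rightarrow> real" where
  "ar2 a1 a2 Y 0 \<omega> = 0"
| "ar2 a1 a2 Y (Suc 0) \<omega> = Y 1 \<omega>"
| "ar2 a1 a2 Y (Suc (Suc n)) \<omega> =
     a1 * ar2 a1 a2 Y (Suc n) \<omega> + a2 * ar2 a1 a2 Y n \<omega> + Y (Suc (Suc n)) \<omega>"

definition region_C :: "(real \<times> real) set" where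
  "region_C = {(a1, a2). a1 \<ge> 2 \<and> a1^2 + 4*a2 > 0}
            \<union> {(a1, a2). 0 < a1 \<and> a1 < 2 \<and> a1 + a2 > 1}
            \<union> {(a1, a2). a1^2 + 4*a2 = 0 \<and> a1 > 2}
            \<union> {(a1, a2). a1 = 0 \<and> a2 > 1}"

definition region_P :: "(real \<times> real) set" where
  "region_P = {(a1, a2). a1 + a2 = 1 \<and> -1 \<le> a2 \<and> a2 \<le> 1}"

definition region_E :: "(real \<times> real) set" where
  "region_E = UNIV - (region_C \<union> region_P)"

definition persist_prob :: "'a measure \<Rightarrow> real \<Rightarrow> real \<Rightarrow> (nat \<Rightarrow> 'a \<Rightarrow> real) \<Rightarrow> nat \<Rightarrow> real" where
  "persist_prob M a1 a2 Y N = measure M {\<omega> \<in> space M. \<forall>n\<in>{1..N}. ar2 a1 a2 Y n \<omega> \<le> 0}"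

end

theory Submission
  imports Defs "HOL-Real_Asymp.Real_Asymp"
begin

text \<open>
  Let \<open>h\<close> be the impulse response, so that \<open>X\<^sub>n = (\<Sum>j<n. h j * Y\<^sub>n\<^sub>-\<^sub>j)\<close>. Outside \<open>C\<close> and \<open>P\<close> one of the following
  holds.

  (1) \<open>a2 \<le> 0\<close> and \<open>h k \<le> 0\<close> for some \<open>k\<close>, which covers complex roots. For the least such \<open>k\<close> the sum
  \<open>\<Sum>j<k. h j * Y\<^sub>n\<^sub>-\<^sub>j\<close> is a combination of \<open>X\<^sub>n, X\<^sub>n\<^sub>-\<^sub>k, X\<^sub>n\<^sub>-\<^sub>k\<^sub>-\<^sub>1\<close> with nonnegative coefficients. Persistence makes
  all these sums nonpositive, and those over disjoint blocks are independent.

  (2) Both roots lie in \<open>[0, 1)\<close>, so \<open>h\<close> is nonnegative and decays geometrically. Up to an event of probability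
  \<open>O(N exp (- N))\<close> all innovations are at most \<open>N powr (1 / \<alpha>)\<close>, so \<open>X\<^sub>n\<close> differs by a small amount from a sum over
  the last \<open>O(ln N)\<close> innovations. Again disjoint blocks are independent.

  (3) One root \<open>s1\<close> is in \<open>(0, 1)\<close> and the other root \<open>s2\<close> is negative. Then \<open>X\<^sub>n - s2 X\<^sub>n\<^sub>-\<^sub>1 \<le> 0\<close> is an AR(1) process to
  which (2) applies.

  (4) The roots are \<open>s \<ge> 1\<close> and \<open>- t\<close> with \<open>t > s\<close>. Persistence forces the component \<open>D\<close> along the expanding
  root \<open>- t\<close> to be polynomially bounded up to a time proportional to \<open>N\<close>. Over a block of length \<open>O(ln N)\<close>, \<open>D\<close> is
  multiplied by a larger power of \<open>N\<close>, so \<open>D\<close> stays bounded only if the first innovation of the block hits a short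
  interval determined by the other innovations. As \<open>Y\<close> is nondegenerate, this has conditional probability at
  most \<open>\<theta> < 1\<close>.
\<close>

section \<open>Impulse response and factorization\<close>

fun impulse :: "real \<Rightarrow> real \<Rightarrow> nat \<Rightarrow> real" where
  "impulse a1 a2 0 = 1"
| "impulse a1 a2 (Suc 0) = a1"
| "impulse a1 a2 (Suc (Suc n)) = a1 * impulse a1 a2 (Suc n) + a2 * impulse a1 a2 n"

lemma ar2_unroll:
  "ar2 a1 a2 Y (i + k + 2) \<omega> =
     impulse a1 a2 (Suc k) * ar2 a1 a2 Y (Suc i) \<omega> + a2 * impulse a1 a2 k * ar2 a1 a2 Y i \<omega>
     + (\<Sum>j<Suc k. impulse a1 a2 j * Y (i + k + 2 - j) \<omega>)"
proof (induction k arbitrary: i)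
  case 0
  show ?case by simp
next
  case (Suc k)
  have "ar2 a1 a2 Y (i + Suc k + 2) \<omega> = ar2 a1 a2 Y (Suc i + k + 2) \<omega>" by simp
  also have "\<dots> = impulse a1 a2 (Suc k) * ar2 a1 a2 Y (Suc (Suc i)) \<omega>
      + a2 * impulse a1 a2 k * ar2 a1 a2 Y (Suc i) \<omega>
      + (\<Sum>j<Suc k. impulse a1 a2 j * Y (Suc i + k + 2 - j) \<omega>)"
    by (rule Suc.IH)
  also have "(\<Sum>j<Suc k. impulse a1 a2 j * Y (Suc i + k + 2 - j) \<omega>)
      = (\<Sum>j<Suc (Suc k). impulse a1 a2 j * Y (i + Suc k + 2 - j) \<omega>)
        - impulse a1 a2 (Suc k) * Y (Suc (Suc i)) \<omega>"
    by (simp add: Suc_diff_le)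
  finally show ?case by (simp add: algebra_simps del: sum.lessThan_Suc)
qed

lemma ar2_moving_average:
  "ar2 a1 a2 Y n \<omega> = (\<Sum>j<n. impulse a1 a2 j * Y (n - j) \<omega>)"
proof -
  consider "n = 0" | "n = 1" | k where "n = 0 + k + 2"
    by (metis One_nat_def add.commute add_0 add_2_eq_Suc not0_implies_Suc)
  then show ?thesis
  proof cases
    case (3 k)
    then show ?thesis unfolding 3 ar2_unroll by simp
  qed simp_all
qed

lemma impulse_nonpos_if_complex_roots:
  assumes disc: "a1\<^sup>2 + 4 * a2 < 0"
  shows "\<exists>k\<ge>1. impulse a1 a2 k \<le> 0"
proof (rule ccontr)
  assume "\<not> ?thesis"
  then have h: "impulse a1 a2 k > 0" for k
    by (cases k) (auto simp: not_le)
  have a1: "a1 > 0" using h[of 1] by simp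
  define r where "r j = impulse a1 a2 (Suc j) / impulse a1 a2 j" for j
  define d where "d = - (a1\<^sup>2 + 4 * a2) / 4"
  have d: "d > 0" using disc by (simp add: d_def)
  have r: "r j > 0" for j using h by (simp add: r_def)
  have rS: "r (Suc j) = a1 + a2 / r j" for j
    using h[of j] h[of "Suc j"] by (simp add: r_def field_simps)
  have step: "r (Suc j) - r j \<le> - d / r j" for j
  proof -
    have "r j ^ 2 - a1 * r j - a2 = (r j - a1 / 2)\<^sup>2 + d"
      by (simp add: d_def power2_eq_square field_simps)
    then have "d \<le> r j ^ 2 - a1 * r j - a2" by simp
    then have "d / r j \<le> (r j ^ 2 - a1 * r j - a2) / r j"
      using r[of j] by (simp add: divide_right_mono)
    also have "\<dots> = r j - r (Suc j)"
      using r[of j] by (simp add: rS field_simps power2_eq_square)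
    finally show ?thesis by simp
  qed
  have bound: "r j \<le> a1 - real j * (d / a1)" for j
  proof (induction j)
    case 0
    show ?case by (simp add: r_def)
  next
    case (Suc j)
    have "0 \<le> real j * (d / a1)" using d a1 by simp
    then have "r j \<le> a1" using Suc by linarith
    then have "d / a1 \<le> d / r j" using r[of j] d by (simp add: frac_le)
    with step[of j] Suc show ?case by (simp add: algebra_simps)
  qed
  obtain j where "real j > a1 / (d / a1)" using reals_Archimedean2 by blast
  then have "real j * (d / a1) > a1" using d a1 by (simp add: field_simps)
  with bound[of j] r[of j] show False by linarith
qed

lemma impulse_factored_Suc:
  "impulse (s1 + s2) (- (s1 * s2)) (Suc n) = s1 ^ Suc n + s2 * impulse (s1 + s2) (- (s1 * s2)) n"
proof (induction n)
  case (Suc n)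
  have "impulse (s1 + s2) (- (s1 * s2)) (Suc (Suc n)) =
      (s1 + s2) * impulse (s1 + s2) (- (s1 * s2)) (Suc n) - s1 * (s2 * impulse (s1 + s2) (- (s1 * s2)) n)"
    by (simp add: algebra_simps)
  also have "s2 * impulse (s1 + s2) (- (s1 * s2)) n = impulse (s1 + s2) (- (s1 * s2)) (Suc n) - s1 ^ Suc n"
    using Suc by simp
  finally show ?case by (simp add: algebra_simps)
qed simp

lemma impulse_geometric_bound:
  assumes "0 \<le> s1" "0 \<le> s2" "s1 \<le> r" "s2 < r"
  shows "0 \<le> impulse (s1 + s2) (- (s1 * s2)) n"
    and "impulse (s1 + s2) (- (s1 * s2)) n \<le> r / (r - s2) * r ^ n"
proof -
  let ?h = "impulse (s1 + s2) (- (s1 * s2))"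
  have "0 \<le> ?h n \<and> ?h n \<le> r / (r - s2) * r ^ n"
  proof (induction n)
    case 0
    show ?case using assms by (simp add: field_simps)
  next
    case (Suc n)
    have "?h (Suc n) = s1 ^ Suc n + s2 * ?h n" by (rule impulse_factored_Suc)
    also have "\<dots> \<le> r ^ Suc n + s2 * (r / (r - s2) * r ^ n)"
      using Suc assms by (intro add_mono power_mono mult_left_mono) auto
    also have "\<dots> = r / (r - s2) * r ^ Suc n"
      using assms by (simp add: field_simps)
    finally have "?h (Suc n) \<le> r / (r - s2) * r ^ Suc n" .
    moreover have "0 \<le> ?h (Suc n)"
      using impulse_factored_Suc[of s1 s2 n] Suc assms by simp
    ultimately show ?case by blast
  qed
  then show "0 \<le> ?h n" "?h n \<le> r / (r - s2) * r ^ n" by auto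
qed

lemma ar2_factor:
  "ar2 s1 0 Y (Suc n) \<omega> = ar2 (s1 + s2) (- (s1 * s2)) Y (Suc n) \<omega> - s2 * ar2 (s1 + s2) (- (s1 * s2)) Y n \<omega>"
proof (induction n)
  case (Suc n)
  have "ar2 s1 0 Y (Suc (Suc n)) \<omega> = s1 * ar2 s1 0 Y (Suc n) \<omega> + Y (Suc (Suc n)) \<omega>" by simp
  then show ?case unfolding Suc by (simp add: algebra_simps)
qed simp

lemma quadratic_factor:
  fixes a1 a2 :: real
  assumes "a1\<^sup>2 + 4 * a2 \<ge> 0"
  obtains s1 s2 where "a1 = s1 + s2" "a2 = - (s1 * s2)" "s2 \<le> s1"
proof
  let ?q = "sqrt (a1\<^sup>2 + 4 * a2)"
  have "?q * ?q = a1\<^sup>2 + 4 * a2" using assms by simp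
  then show "a2 = - ((a1 + ?q) / 2 * ((a1 - ?q) / 2))"
    by (simp add: field_simps power2_eq_square)
  show "(a1 - ?q) / 2 \<le> (a1 + ?q) / 2" using assms by simp
qed (simp add: field_simps)

lemma ar1_moving_average: "ar2 c 0 Y n \<omega> = (\<Sum>j<n. c ^ j * Y (n - j) \<omega>)"
proof -
  have "impulse c 0 j = c ^ j" for j
    by (induction c "0 :: real" j rule: impulse.induct) auto
  then show ?thesis by (simp add: ar2_moving_average)
qed

lemma ar1_Suc: "ar2 c 0 Y (Suc n) \<omega> = c * ar2 c 0 Y n \<omega> + Y (Suc n) \<omega>"
  by (cases n) auto

lemma ar1_unroll:
  "ar2 c 0 Y (n + L) \<omega> = c ^ L * ar2 c 0 Y n \<omega> + (\<Sum>j<L. c ^ j * Y (n + L - j) \<omega>)"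
proof (induction L)
  case (Suc L)
  have "ar2 c 0 Y (n + Suc L) \<omega> = c * ar2 c 0 Y (n + L) \<omega> + Y (n + Suc L) \<omega>"
    using ar1_Suc by simp
  also have "\<dots> = c ^ Suc L * ar2 c 0 Y n \<omega>
      + ((\<Sum>j<L. c ^ Suc j * Y (n + L - j) \<omega>) + Y (n + Suc L) \<omega>)"
    unfolding Suc by (simp add: algebra_simps sum_distrib_left)
  also have "(\<Sum>j<L. c ^ Suc j * Y (n + L - j) \<omega>) + Y (n + Suc L) \<omega>
      = (\<Sum>j<Suc L. c ^ j * Y (n + Suc L - j) \<omega>)"
    by (subst sum.lessThan_Suc_shift) simp
  finally show ?case .
qed simp

lemma sum_power_tail_le:
  fixes r :: real
  assumes "0 \<le> r" "r < 1"
  shows "(\<Sum>j\<in>{L..<n}. r ^ j) \<le> r ^ L / (1 - r)"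
proof (cases "L \<le> n")
  case True
  then have "(\<Sum>j\<in>{L..<n}. r ^ j) = r ^ L * (\<Sum>i<n - L. r ^ i)"
    by (simp add: sum.atLeastLessThan_shift_0[of _ L n] atLeast0LessThan power_add sum_distrib_left)
  also have "\<dots> = r ^ L * ((1 - r ^ (n - L)) / (1 - r))"
    using assms by (simp add: sum_gp_strict)
  also have "\<dots> \<le> r ^ L * (1 / (1 - r))"
    using assms by (intro mult_left_mono divide_right_mono) auto
  finally show ?thesis by simp
qed (use assms in simp)

lemma power_nat_ceiling_ln:
  fixes t b x :: real
  assumes "0 < t" "1 \<le> x" "0 \<le> b"
  shows "1 \<le> t \<Longrightarrow> x powr (b * ln t) \<le> t ^ nat \<lceil>b * ln x\<rceil>"
    and "t \<le> 1 \<Longrightarrow> t ^ nat \<lceil>b * ln x\<rceil> \<le> x powr (b * ln t)"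
proof -
  have L: "b * ln x \<le> real (nat \<lceil>b * ln x\<rceil>)" by linarith
  have eq: "x powr (b * ln t) = exp (b * ln x * ln t)"
    using assms by (simp add: powr_def mult_ac)
  have tL: "t ^ nat \<lceil>b * ln x\<rceil> = exp (real (nat \<lceil>b * ln x\<rceil>) * ln t)"
    by (subst exp_of_nat_mult) (use assms in simp)
  show "x powr (b * ln t) \<le> t ^ nat \<lceil>b * ln x\<rceil>" if "1 \<le> t"
    unfolding eq tL using L that by (simp add: mult_right_mono)
  show "t ^ nat \<lceil>b * ln x\<rceil> \<le> x powr (b * ln t)" if "t \<le> 1"
    unfolding eq tL using L that assms by (simp add: mult_right_mono_neg)
qed

lemma mult_le_of_less_nat_floor_divide:
  assumes "i < nat \<lfloor>x / real L\<rfloor>" "0 < L"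
  shows "real (Suc i * L) \<le> x"
proof -
  have "int (Suc i) \<le> \<lfloor>x / real L\<rfloor>" using assms(1) by linarith
  then have "real (Suc i) \<le> x / real L" by (simp add: le_floor_iff)
  then show ?thesis using assms(2) by (simp add: field_simps)
qed

lemma stretched_exponential_bigo:
  fixes p :: "nat \<Rightarrow> real"
  assumes "0 < \<theta>" "\<theta> < 1" "0 < c" "0 < b" "0 \<le> C"
    and nonneg: "\<And>N. 0 \<le> p N"
    and bound: "\<forall>\<^sub>F N in sequentially.
      p N \<le> C * real N * exp (- real N) + \<theta> ^ nat \<lfloor>c * real N / nat \<lceil>b * ln (real N)\<rceil>\<rfloor>"
  shows "\<exists>l>0. p \<in> O(\<lambda>N. exp (- l * real N / ln (real N)))"
proof -
  define l where "l = min (1/2) (- ln \<theta> * c / (b + 1))"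
  have lnt: "ln \<theta> < 0" using assms by simp
  have l: "l > 0" "l \<le> 1/2" "l \<le> - ln \<theta> * c / (b + 1)"
  proof -
    show "l > 0" using assms lnt by (simp add: l_def mult_neg_pos divide_neg_pos)
  qed (unfold l_def, rule min.cobounded1, rule min.cobounded2)
  have "\<forall>\<^sub>F N in sequentially. ln (real N) \<ge> 1" by real_asymp
  with bound have "\<forall>\<^sub>F N in sequentially. norm (p N) \<le> (2 * C + 1 / \<theta>) * norm (exp (- l * real N / ln (real N)))"
  proof eventually_elim
    case (elim N)
    define L where "L = nat \<lceil>b * ln (real N)\<rceil>"
    define m where "m = nat \<lfloor>c * real N / L\<rfloor>"
    define x where "x = real N / ln (real N)"
    have x: "0 \<le> x" "x \<le> real N" using elim mult_left_mono[of 1 "ln (real N)" "real N"] by (auto simp: x_def divide_le_eq)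
    have bl: "0 < b * ln (real N)" using elim assms by simp
    then have L0: "real L > 0" by (simp add: L_def)
    have "real L \<le> b * ln (real N) + 1" using bl by (simp add: L_def)
    also have "\<dots> \<le> (b + 1) * ln (real N)" using elim by (simp add: algebra_simps)
    finally have L: "real L \<le> (b + 1) * ln (real N)" .
    have "c / (b + 1) * x = c * real N / ((b + 1) * ln (real N))" by (simp add: x_def)
    also have "\<dots> \<le> c * real N / L"
      using L L0 assms by (intro divide_left_mono) (auto intro!: mult_pos_pos simp: mult_less_0_iff)
    also have "\<dots> \<le> real m + 1"
      unfolding m_def using L0 assms by (simp add: of_nat_nat) 
    finally have m: "c / (b + 1) * x - 1 \<le> real m" by simp
    have "\<theta> ^ m = exp (real m * ln \<theta>)" using assms by (simp add: exp_of_nat_mult)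
    also have "real m * ln \<theta> \<le> (c / (b + 1) * x - 1) * ln \<theta>"
      using m lnt by (intro mult_right_mono_neg) auto
    also have "\<dots> = - (- ln \<theta> * c / (b + 1)) * x - ln \<theta>" by (simp add: field_simps)
    also have "\<dots> \<le> - l * x - ln \<theta>" using mult_right_mono[OF l(3) x(1)] by simp
    also have "exp (- l * x - ln \<theta>) = 1 / \<theta> * exp (- l * x)" using assms by (simp add: exp_diff)
    finally have 1: "\<theta> ^ m \<le> 1 / \<theta> * exp (- l * x)" by simp
    have "real N / 2 \<le> exp (real N / 2)" using exp_ge_add_one_self[of "real N / 2"] by linarith
    then have "real N * exp (- real N) \<le> 2 * exp (real N / 2) * exp (- real N)"
      by (intro mult_right_mono) auto
    also have "\<dots> = 2 * exp (- real N / 2)" by (simp flip: exp_add)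
    also have "\<dots> \<le> 2 * exp (- l * x)"
      using mult_mono[OF l(2) x(2)] l x by simp
    finally have "C * real N * exp (- real N) \<le> 2 * C * exp (- l * x)"
      using mult_left_mono[OF _ \<open>0 \<le> C\<close>] by (fastforce simp: mult_ac)
    with elim(1) 1 have "p N \<le> 2 * C * exp (- l * x) + 1 / \<theta> * exp (- l * x)"
      unfolding m_def L_def by linarith
    then show ?case using nonneg[of N] by (simp add: x_def algebra_simps)
  qed
  then have "p \<in> O(\<lambda>N. exp (- l * real N / ln (real N)))" by (rule bigoI)
  with l show ?thesis by blast
qed

section \<open>Products of conditional probabilities\<close>

context prob_space
begin

lemma indep_var_prob_le:
  assumes indep: "indep_var S A T R"
    and B: "B \<in> sets (S \<Otimes>\<^sub>M T)" and C: "C \<in> sets T"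
    and bound: "\<And>r. r \<in> space T \<Longrightarrow> prob {\<omega> \<in> space M. (A \<omega>, r) \<in> B} \<le> \<theta>"
  shows "prob {\<omega> \<in> space M. (A \<omega>, R \<omega>) \<in> B \<and> R \<omega> \<in> C} \<le> \<theta> * prob {\<omega> \<in> space M. R \<omega> \<in> C}"
proof -
  have rv [measurable]: "A \<in> measurable M S" "R \<in> measurable M T"
    and eq: "distr M S A \<Otimes>\<^sub>M distr M T R = distr M (S \<Otimes>\<^sub>M T) (\<lambda>x. (A x, R x))"
    using indep by (auto simp: indep_var_distribution_eq)
  note [measurable] = B C
  interpret A: prob_space "distr M S A" by (rule prob_space_distr) simp
  interpret R: prob_space "distr M T R" by (rule prob_space_distr) simp
  interpret AR: pair_prob_space "distr M S A" "distr M T R" ..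
  obtain \<omega>0 where "\<omega>0 \<in> space M" using not_empty by blast
  with rv(2) have "R \<omega>0 \<in> space T" by (rule measurable_space)
  from order_trans[OF _ bound[OF this]] have \<theta>: "0 \<le> \<theta>" by simp
  let ?D = "B \<inter> (space S \<times> C)"
  have D: "?D \<in> sets (S \<Otimes>\<^sub>M T)" by measurable
  have "emeasure M {\<omega> \<in> space M. (A \<omega>, R \<omega>) \<in> B \<and> R \<omega> \<in> C}
      = emeasure (distr M (S \<Otimes>\<^sub>M T) (\<lambda>x. (A x, R x))) ?D"
    using D measurable_space[OF rv(1)]
    by (subst emeasure_distr) (auto intro!: arg_cong[where f = "emeasure M"])
  also have "\<dots> = (\<integral>\<^sup>+y. emeasure (distr M S A) ((\<lambda>x. (x, y)) -` ?D) \<partial>distr M T R)"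
    using D by (subst eq[symmetric], subst AR.emeasure_pair_measure_alt2) auto
  also have "\<dots> \<le> (\<integral>\<^sup>+y. ennreal \<theta> * indicator C y \<partial>distr M T R)"
  proof (intro nn_integral_mono)
    fix y assume y: "y \<in> space (distr M T R)"
    show "emeasure (distr M S A) ((\<lambda>x. (x, y)) -` ?D) \<le> ennreal \<theta> * indicator C y"
    proof (cases "y \<in> C")
      case True
      have "(\<lambda>x. (x, y)) -` ?D \<in> sets S" using D by (rule sets_Pair2)
      then have "emeasure (distr M S A) ((\<lambda>x. (x, y)) -` ?D)
          = emeasure M {\<omega> \<in> space M. (A \<omega>, y) \<in> B}"
        using True measurable_space[OF rv(1)]
        by (subst emeasure_distr) (auto intro!: arg_cong[where f = "emeasure M"])
      also have "\<dots> \<le> ennreal \<theta>"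
        using bound[of y] y by (simp add: emeasure_eq_measure ennreal_leI)
      finally show ?thesis using True by simp
    qed simp
  qed
  also have "\<dots> = ennreal \<theta> * emeasure M {\<omega> \<in> space M. R \<omega> \<in> C}"
    by (simp add: nn_integral_cmult_indicator emeasure_distr vimage_def Int_def conj_commute)
  finally show ?thesis
    using \<theta> by (simp add: emeasure_eq_measure flip: ennreal_mult)
qed

lemma indep_vars_chain_prob_le:
  fixes U :: "nat \<Rightarrow> 'a \<Rightarrow> real"
  assumes indep: "indep_vars (\<lambda>_. borel) U UNIV"
    and B: "B \<in> sets (borel \<Otimes>\<^sub>M borel)"
    and bound: "\<And>i w. prob {\<omega> \<in> space M. (w, U i \<omega>) \<in> B} \<le> \<theta>" and "0 \<le> \<theta>"
  shows "prob {\<omega> \<in> space M. \<forall>i<m. ((\<Sum>j<i. c ^ (i - 1 - j) * U j \<omega>), U i \<omega>) \<in> B} \<le> \<theta> ^ m"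
proof (induction m)
  case (Suc m)
  define w where "w i u = (\<Sum>j<i. c ^ (i - 1 - j) * (u j :: real))" for i u
  let ?P = "PiM {..<m} (\<lambda>_. borel :: real measure)"
  let ?R = "\<lambda>\<omega>. restrict (\<lambda>i. U i \<omega>) {..<m}"
  let ?S = "PiM {m} (\<lambda>_. borel :: real measure)"
  let ?A = "\<lambda>\<omega>. restrict (\<lambda>i. U i \<omega>) {m}"
  have ind: "indep_var ?S ?A ?P ?R"
    using indep by (rule indep_var_restrict) auto
  have w: "w i \<in> borel_measurable ?P" if "i \<le> m" for i
    unfolding w_def using that by (intro borel_measurable_sum borel_measurable_times) auto
  define B' where "B' = {z \<in> space (?S \<Otimes>\<^sub>M ?P). (w m (snd z), fst z m) \<in> B}"
  define C where "C = {u \<in> space ?P. \<forall>i<m. (w i u, u i) \<in> B}"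
  have "B' \<in> sets (?S \<Otimes>\<^sub>M ?P)"
  proof -
    have "(\<lambda>z. w m (snd z)) \<in> borel_measurable (?S \<Otimes>\<^sub>M ?P)"
      by (rule measurable_compose[OF measurable_snd w]) simp
    moreover have "(\<lambda>z. fst z m) \<in> borel_measurable (?S \<Otimes>\<^sub>M ?P)"
      by (rule measurable_compose[OF measurable_fst measurable_component_singleton]) simp
    ultimately have "(\<lambda>z. (w m (snd z), fst z m)) \<in> measurable (?S \<Otimes>\<^sub>M ?P) (borel \<Otimes>\<^sub>M borel)"
      by (rule measurable_Pair)
    from measurable_sets[OF this B] show ?thesis
      by (simp add: B'_def vimage_def Int_def conj_commute)
  qed
  moreover have "C \<in> sets ?P"
  proof -
    have "{u \<in> space ?P. \<forall>i\<in>{..<m}. (w i u, u i) \<in> B} \<in> sets ?P"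
    proof (intro sets.sets_Collect_finite_All)
      fix i assume i: "i \<in> {..<m}"
      then have "(\<lambda>u. (w i u, u i)) \<in> measurable ?P (borel \<Otimes>\<^sub>M borel)"
        by (intro measurable_Pair w) auto
      from measurable_sets[OF this B] show "{u \<in> space ?P. (w i u, u i) \<in> B} \<in> sets ?P"
        by (simp add: vimage_def Int_def conj_commute)
    qed simp
    then show ?thesis unfolding C_def Ball_def lessThan_iff .
  qed
  moreover have "prob {\<omega> \<in> space M. (?A \<omega>, r) \<in> B'} \<le> \<theta>" if "r \<in> space ?P" for r
    using bound[of "w m r" m] that by (simp add: B'_def space_pair_measure space_PiM)
  ultimately have le: "prob {\<omega> \<in> space M. (?A \<omega>, ?R \<omega>) \<in> B' \<and> ?R \<omega> \<in> C}
      \<le> \<theta> * prob {\<omega> \<in> space M. ?R \<omega> \<in> C}"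
    by (rule indep_var_prob_le[OF ind])
  have wR: "w i (?R \<omega>) = w i (\<lambda>j. U j \<omega>)" if "i \<le> m" for i \<omega>
    unfolding w_def using that by (intro sum.cong) auto
  have C_iff: "?R \<omega> \<in> C \<longleftrightarrow> (\<forall>i<m. (w i (\<lambda>j. U j \<omega>), U i \<omega>) \<in> B)" for \<omega>
    unfolding C_def by (simp add: space_PiM wR)
  have B_iff: "(?A \<omega>, ?R \<omega>) \<in> B' \<longleftrightarrow> (w m (\<lambda>j. U j \<omega>), U m \<omega>) \<in> B" for \<omega>
    unfolding B'_def by (simp add: space_PiM space_pair_measure wR)
  have "prob {\<omega> \<in> space M. (w m (\<lambda>j. U j \<omega>), U m \<omega>) \<in> B \<and> (\<forall>i<m. (w i (\<lambda>j. U j \<omega>), U i \<omega>) \<in> B)}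
      \<le> \<theta> * prob {\<omega> \<in> space M. \<forall>i<m. (w i (\<lambda>j. U j \<omega>), U i \<omega>) \<in> B}"
    using le unfolding C_iff B_iff .
  also have "\<dots> \<le> \<theta> * \<theta> ^ m"
    unfolding w_def using Suc \<open>0 \<le> \<theta>\<close> by (rule mult_left_mono)
  finally have le': "prob {\<omega> \<in> space M. (w m (\<lambda>j. U j \<omega>), U m \<omega>) \<in> B \<and> (\<forall>i<m. (w i (\<lambda>j. U j \<omega>), U i \<omega>) \<in> B)}
      \<le> \<theta> * \<theta> ^ m" .
  have split: "(\<forall>i<Suc m. Q i) \<longleftrightarrow> Q m \<and> (\<forall>i<m. Q i)" for Q
    by (auto simp: less_Suc_eq)
  show ?case
    using le' unfolding w_def power_Suc split .
qed (simp add: prob_space)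

end

section \<open>Sequences of i.i.d. innovations\<close>

locale iid_reals = prob_space M for M :: "'a measure" +
  fixes Y :: "nat \<Rightarrow> 'a \<Rightarrow> real"
  assumes indep: "indep_vars (\<lambda>_. borel) Y {1..}"
    and ident: "\<And>n. n \<ge> 1 \<Longrightarrow> distr M borel (Y n) = distr M borel (Y 1)"
begin

lemma rv [measurable]: "n \<ge> 1 \<Longrightarrow> Y n \<in> borel_measurable M"
  using indep by (auto simp: indep_vars_def)

lemma prob_ident:
  assumes "n \<ge> 1" "S \<in> sets borel"
  shows "prob {\<omega> \<in> space M. Y n \<omega> \<in> S} = prob {\<omega> \<in> space M. Y 1 \<omega> \<in> S}"
proof -
  have "prob {\<omega> \<in> space M. Y k \<omega> \<in> S} = measure (distr M borel (Y k)) S" if "k \<ge> 1" for k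
    using rv[OF that] assms(2) by (simp add: measure_distr vimage_def Int_def conj_commute)
  then show ?thesis using ident[OF assms(1)] assms(1) by simp
qed

definition block :: "(nat \<Rightarrow> real) \<Rightarrow> nat \<Rightarrow> nat \<Rightarrow> 'a \<Rightarrow> real" where
  "block g L i \<omega> = (\<Sum>j<L. g j * Y (Suc i * L - j) \<omega>)"

lemma indep_blocks: "indep_vars (\<lambda>_. borel) (block g L) UNIV"
proof -
  let ?K = "\<lambda>i. {i * L<..Suc i * L}"
  define f where "f i u = (\<Sum>j<L. g j * (u (Suc i * L - j) :: real))" for i u
  have K: "Suc i * L - j \<in> ?K i" if "j < L" for i j using that by auto
  have "disjoint_family_on ?K UNIV"
  proof (unfold disjoint_family_on_def, intro ballI impI)
    have lt: "?K m \<inter> ?K n = {}" if "m < n" for m n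
    proof -
      have "Suc m * L \<le> n * L" using that by (intro mult_right_mono) auto
      then show ?thesis by auto
    qed
    fix m n :: nat assume "m \<noteq> n"
    then show "?K m \<inter> ?K n = {}" using lt[of m n] lt[of n m] by (cases m n rule: linorder_cases) auto
  qed
  then have "indep_vars (\<lambda>i. PiM (?K i) (\<lambda>_. borel)) (\<lambda>i \<omega>. restrict (\<lambda>k. Y k \<omega>) (?K i)) UNIV"
    by (intro indep_vars_restrict[OF indep]) auto
  then have "indep_vars (\<lambda>_. borel) (\<lambda>i \<omega>. f i (restrict (\<lambda>k. Y k \<omega>) (?K i))) UNIV"
  proof (rule indep_vars_compose2)
    show "f i \<in> borel_measurable (PiM (?K i) (\<lambda>_. borel))" for i
      unfolding f_def
      by (intro borel_measurable_sum borel_measurable_times borel_measurable_const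
          measurable_component_singleton K) simp
  qed
  also have "(\<lambda>i \<omega>. f i (restrict (\<lambda>k. Y k \<omega>) (?K i))) = block g L"
    unfolding f_def block_def by (intro ext sum.cong refl) (simp only: restrict_apply' K lessThan_iff)
  finally show ?thesis .
qed

lemma block_measurable [measurable]: "block g L i \<in> borel_measurable M"
  using indep_blocks by (auto simp: indep_vars_def)

lemma prob_blocks_le:
  assumes "\<And>i. prob {\<omega> \<in> space M. block g L i \<omega> \<le> e} \<le> \<theta>" "0 \<le> \<theta>"
  shows "prob {\<omega> \<in> space M. \<forall>i<m. block g L i \<omega> \<le> e} \<le> \<theta> ^ m"
proof -
  have "(UNIV :: real set) \<times> {..e} \<in> sets (borel \<Otimes>\<^sub>M borel)"
    by (intro pair_measureI) auto
  then have "prob {\<omega> \<in> space M. \<forall>i<m. ((\<Sum>j<i. 0 ^ (i - 1 - j) * block g L j \<omega>), block g L i \<omega>) \<in> UNIV \<times> {..e}}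
      \<le> \<theta> ^ m"
    by (rule indep_vars_chain_prob_le[OF indep_blocks]) (use assms in simp_all)
  then show ?thesis by (simp only: mem_Sigma_iff UNIV_I atMost_iff simp_thms)
qed

lemma integrable_abs_ident:
  assumes int: "integrable M (Y 1)" and "n \<ge> 1"
  shows "integrable M (\<lambda>\<omega>. \<bar>Y n \<omega>\<bar>)" and "expectation (\<lambda>\<omega>. \<bar>Y n \<omega>\<bar>) = expectation (\<lambda>\<omega>. \<bar>Y 1 \<omega>\<bar>)"
proof -
  have "integrable M (\<lambda>\<omega>. \<bar>Y 1 \<omega>\<bar>)" using int by simp
  then have "integrable (distr M borel (Y 1)) abs"
    using rv[of 1] by (subst integrable_distr_eq) auto
  then show "integrable M (\<lambda>\<omega>. \<bar>Y n \<omega>\<bar>)"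
    using rv[OF assms(2)] by (subst (asm) ident[OF assms(2), symmetric], subst (asm) integrable_distr_eq) auto
  have "expectation (\<lambda>\<omega>. \<bar>Y k \<omega>\<bar>) = integral\<^sup>L (distr M borel (Y k)) abs" if "k \<ge> 1" for k
    using rv[OF that] by (subst integral_distr) auto
  then show "expectation (\<lambda>\<omega>. \<bar>Y n \<omega>\<bar>) = expectation (\<lambda>\<omega>. \<bar>Y 1 \<omega>\<bar>)"
    using ident[OF assms(2)] assms(2) by simp
qed

lemma prob_gt_level:
  assumes "0 < prob {\<omega> \<in> space M. Y 1 \<omega> > 0}"
  obtains y where "0 < y" "0 < prob {\<omega> \<in> space M. Y 1 \<omega> > y}"
proof (rule ccontr)
  assume neg: "\<not> thesis"
  have [measurable]: "Y 1 \<in> borel_measurable M" by (rule rv) simp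
  have zero: "prob {\<omega> \<in> space M. Y 1 \<omega> > 1 / real (Suc n)} = 0" for n
  proof (rule ccontr)
    assume "prob {\<omega> \<in> space M. Y 1 \<omega> > 1 / real (Suc n)} \<noteq> 0"
    then have "0 < prob {\<omega> \<in> space M. Y 1 \<omega> > 1 / real (Suc n)}" by (rule zero_less_measure_iff[THEN iffD2])
    with neg that[of "1 / real (Suc n)"] show False by simp
  qed
  have "{\<omega> \<in> space M. Y 1 \<omega> > 1 / real (Suc n)} \<in> null_sets M" for n
    using zero[of n] by (intro null_setsI) (simp_all add: emeasure_eq_measure)
  then have "(\<Union>n. {\<omega> \<in> space M. Y 1 \<omega> > 1 / real (Suc n)}) \<in> null_sets M"
    by (rule null_sets_UN)
  also have "(\<Union>n. {\<omega> \<in> space M. Y 1 \<omega> > 1 / real (Suc n)}) = {\<omega> \<in> space M. Y 1 \<omega> > 0}"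
  proof (intro equalityI subsetI)
    fix \<omega> assume "\<omega> \<in> {\<omega> \<in> space M. Y 1 \<omega> > 0}"
    then show "\<omega> \<in> (\<Union>n. {\<omega> \<in> space M. Y 1 \<omega> > 1 / real (Suc n)})"
      using reals_Archimedean[of "Y 1 \<omega>"] by (auto simp: inverse_eq_divide)
  next
    fix \<omega> assume "\<omega> \<in> (\<Union>n. {\<omega> \<in> space M. Y 1 \<omega> > 1 / real (Suc n)})"
    then obtain n where "\<omega> \<in> space M" "1 / real (Suc n) < Y 1 \<omega>" by blast
    moreover have "0 < 1 / real (Suc n)" by simp
    ultimately show "\<omega> \<in> {\<omega> \<in> space M. Y 1 \<omega> > 0}" using less_trans by blast
  qed
  finally show False using assms by (simp add: null_sets_def measure_def)
qed

lemma prob_all_gt: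
  assumes "finite I" "I \<subseteq> {1..}"
  shows "prob {\<omega> \<in> space M. \<forall>k\<in>I. Y k \<omega> > y} = prob {\<omega> \<in> space M. Y 1 \<omega> > y} ^ card I"
proof (cases "I = {}")
  case False
  have "prob (\<Inter>k\<in>I. Y k -` {y<..} \<inter> space M) = (\<Prod>k\<in>I. prob (Y k -` {y<..} \<inter> space M))"
    using False assms by (intro indep_varsD[OF indep]) auto
  also have "\<dots> = (\<Prod>k\<in>I. prob {\<omega> \<in> space M. Y 1 \<omega> > y})"
  proof (intro prod.cong refl)
    fix k assume "k \<in> I"
    with assms have "k \<ge> 1" by auto
    from prob_ident[OF this, of "{y<..}"]
    show "prob (Y k -` {y<..} \<inter> space M) = prob {\<omega> \<in> space M. Y 1 \<omega> > y}"
      by (simp add: vimage_def Int_def conj_commute)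
  qed
  also have "(\<Inter>k\<in>I. Y k -` {y<..} \<inter> space M) = {\<omega> \<in> space M. \<forall>k\<in>I. Y k \<omega> > y}"
    using False by auto
  finally show ?thesis by simp
qed (simp add: prob_space)

lemma prob_weighted_abs_sum_ge:
  assumes int: "integrable M (Y 1)" and I: "finite I" "\<And>j. j \<in> I \<Longrightarrow> k j \<ge> 1"
    and g: "\<And>j. j \<in> I \<Longrightarrow> 0 \<le> g j" and "0 < a"
  shows "prob {\<omega> \<in> space M. a \<le> (\<Sum>j\<in>I. g j * \<bar>Y (k j) \<omega>\<bar>)} \<le> sum g I * expectation (\<lambda>\<omega>. \<bar>Y 1 \<omega>\<bar>) / a"
proof -
  note ii = integrable_abs_ident[OF int]
  have 1: "integrable M (\<lambda>\<omega>. \<Sum>j\<in>I. g j * \<bar>Y (k j) \<omega>\<bar>)"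
    by (intro Bochner_Integration.integrable_sum integrable_mult_right ii(1) I(2))
  have "expectation (\<lambda>\<omega>. \<Sum>j\<in>I. g j * \<bar>Y (k j) \<omega>\<bar>) = (\<Sum>j\<in>I. expectation (\<lambda>\<omega>. g j * \<bar>Y (k j) \<omega>\<bar>))"
    by (intro Bochner_Integration.integral_sum integrable_mult_right ii(1) I(2))
  also have "\<dots> = (\<Sum>j\<in>I. g j * expectation (\<lambda>\<omega>. \<bar>Y 1 \<omega>\<bar>))"
    by (intro sum.cong refl) (simp add: ii(2)[OF I(2)])
  also have "\<dots> = sum g I * expectation (\<lambda>\<omega>. \<bar>Y 1 \<omega>\<bar>)" by (simp add: sum_distrib_right)
  finally have 2: "expectation (\<lambda>\<omega>. \<Sum>j\<in>I. g j * \<bar>Y (k j) \<omega>\<bar>) = sum g I * expectation (\<lambda>\<omega>. \<bar>Y 1 \<omega>\<bar>)" .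
  have "prob {\<omega> \<in> space M. a \<le> (\<Sum>j\<in>I. g j * \<bar>Y (k j) \<omega>\<bar>)}
      \<le> expectation (\<lambda>\<omega>. \<Sum>j\<in>I. g j * \<bar>Y (k j) \<omega>\<bar>) / a"
    using 1 g \<open>0 < a\<close> by (intro integral_Markov_inequality_measure[where A = "{}"]) (auto intro!: sum_nonneg)
  then show ?thesis unfolding 2 .
qed

lemma prob_block_le:
  assumes int: "integrable M (Y 1)" and pos: "0 < prob {\<omega> \<in> space M. Y 1 \<omega> > 0}"
    and g: "\<And>j. 0 \<le> g j" "g 0 = 1" "summable g"
  obtains e \<theta> where "0 < e" "0 < \<theta>" "\<theta> < 1"
    "\<And>L i. L \<ge> 1 \<Longrightarrow> prob {\<omega> \<in> space M. block g L i \<omega> \<le> e} \<le> \<theta>"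
proof -
  obtain y where y: "0 < y" "0 < prob {\<omega> \<in> space M. Y 1 \<omega> > y}" using prob_gt_level[OF pos] .
  define p where "p = prob {\<omega> \<in> space M. Y 1 \<omega> > y}"
  have p: "0 < p" "p \<le> 1" using y by (auto simp: p_def)
  define m where "m = expectation (\<lambda>\<omega>. \<bar>Y 1 \<omega>\<bar>)"
  have m: "0 \<le> m" unfolding m_def by (intro Bochner_Integration.integral_nonneg) simp
  define d where "d = y / (4 * (m + 1))"
  have d: "0 < d" "d * m \<le> y / 4"
  proof -
    show "0 < d" using y m by (simp add: d_def)
    have "d * m = y / 4 * (m / (m + 1))" by (simp add: d_def)
    also have "\<dots> \<le> y / 4 * 1" using m y by (intro mult_left_mono) auto
    finally show "d * m \<le> y / 4" by simp
  qed
  obtain J0 where J0: "\<And>n. n \<ge> J0 \<Longrightarrow> norm (\<Sum>i. g (i + n)) < d"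
    using suminf_exist_split[OF d(1) g(3)] by blast
  define J where "J = Suc J0"
  have tail: "sum g {J..<L} \<le> d" for L
  proof (cases "J \<le> L")
    case True
    have "sum g {J..<L} = (\<Sum>i<L - J. g (i + J))"
      using True by (simp add: sum.atLeastLessThan_shift_0[of g J L] atLeast0LessThan add.commute)
    also have "\<dots> \<le> (\<Sum>i. g (i + J))"
      using g by (intro sum_le_suminf) (auto intro: summable_ignore_initial_segment)
    also have "\<dots> < d" using J0[of J] by (simp add: J_def)
    finally show ?thesis by simp
  qed (use d in simp)
  have pJ: "0 < p ^ J" "p ^ J \<le> 1" using p by (auto simp: power_le_one)
  show thesis
  proof
    show "0 < y / 2" "0 < 1 - p ^ J / 2" "1 - p ^ J / 2 < 1" using y pJ by auto
    fix L i :: nat assume L: "L \<ge> 1"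
    define n where "n = Suc i * L"
    define J' where "J' = min J L"
    have n: "n \<ge> L" by (simp add: n_def)
    have J': "1 \<le> J'" "J' \<le> L" "J' \<le> J" using L by (auto simp: J'_def J_def)
    define H where "H = {n - J'<..n}"
    define T where "T = {n - L<..n - J'}"
    let ?S = "\<lambda>I. PiM I (\<lambda>_. borel :: real measure)"
    define t where "t u = (\<Sum>j\<in>{J'..<L}. g j * \<bar>u (n - j) :: real\<bar>)" for u
    have HT: "H \<inter> T = {}" "H \<subseteq> {1..}" "T \<subseteq> {1..}" "finite H" "card H = J'"
      using n J' by (auto simp: H_def T_def)
    have inT: "n - j \<in> T" if "j \<in> {J'..<L}" for j using that n by (auto simp: T_def)
    have ind: "indep_var (?S H) (\<lambda>\<omega>. restrict (\<lambda>k. Y k \<omega>) H) (?S T) (\<lambda>\<omega>. restrict (\<lambda>k. Y k \<omega>) T)"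
      using indep HT(1-3) by (rule indep_var_restrict)
    define A where "A = {u \<in> space (?S H). \<forall>k\<in>H. y < u k}"
    define B where "B = {u \<in> space (?S T). t u < y / 2}"
    have A: "A \<in> sets (?S H)"
      unfolding A_def
    proof (intro sets.sets_Collect_finite_All HT)
      fix k assume "k \<in> H"
      then have "(\<lambda>u. u k) \<in> borel_measurable (?S H)" by (rule measurable_component_singleton)
      then show "{u \<in> space (?S H). y < u k} \<in> sets (?S H)" by measurable
    qed
    have tm: "t \<in> borel_measurable (?S T)"
      unfolding t_def
      by (intro borel_measurable_sum borel_measurable_times borel_measurable_const borel_measurable_abs
          measurable_component_singleton inT)
    then have B: "B \<in> sets (?S T)" unfolding B_def by measurable
    have tR: "t (restrict (\<lambda>k. Y k \<omega>) T) = t (\<lambda>k. Y k \<omega>)" for \<omega>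
      unfolding t_def by (intro sum.cong refl) (simp only: restrict_apply' inT)
    have "prob ((\<lambda>\<omega>. (restrict (\<lambda>k. Y k \<omega>) H, restrict (\<lambda>k. Y k \<omega>) T)) -` (A \<times> B) \<inter> space M)
      = prob ((\<lambda>\<omega>. restrict (\<lambda>k. Y k \<omega>) H) -` A \<inter> space M) * prob ((\<lambda>\<omega>. restrict (\<lambda>k. Y k \<omega>) T) -` B \<inter> space M)"
      by (rule indep_varD[OF ind A B])
    also have "(\<lambda>\<omega>. (restrict (\<lambda>k. Y k \<omega>) H, restrict (\<lambda>k. Y k \<omega>) T)) -` (A \<times> B) \<inter> space M
      = {\<omega> \<in> space M. (\<forall>k\<in>H. y < Y k \<omega>) \<and> t (\<lambda>k. Y k \<omega>) < y / 2}"
      by (auto simp: A_def B_def tR space_PiM)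
    also have "(\<lambda>\<omega>. restrict (\<lambda>k. Y k \<omega>) H) -` A \<inter> space M = {\<omega> \<in> space M. \<forall>k\<in>H. y < Y k \<omega>}"
      by (auto simp: A_def space_PiM)
    also have "(\<lambda>\<omega>. restrict (\<lambda>k. Y k \<omega>) T) -` B \<inter> space M = {\<omega> \<in> space M. t (\<lambda>k. Y k \<omega>) < y / 2}"
      by (auto simp: B_def tR space_PiM)
    also have "prob {\<omega> \<in> space M. \<forall>k\<in>H. y < Y k \<omega>} = p ^ J'"
      using prob_all_gt[OF HT(4,2)] HT(5) by (simp add: p_def)
    finally have prod: "prob {\<omega> \<in> space M. (\<forall>k\<in>H. y < Y k \<omega>) \<and> t (\<lambda>k. Y k \<omega>) < y / 2}
      = p ^ J' * prob {\<omega> \<in> space M. t (\<lambda>k. Y k \<omega>) < y / 2}" .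
    have tM: "(\<lambda>\<omega>. t (\<lambda>k. Y k \<omega>)) \<in> borel_measurable M"
      unfolding t_def using HT(3) inT
      by (intro borel_measurable_sum borel_measurable_times borel_measurable_const borel_measurable_abs rv) auto
    have "prob {\<omega> \<in> space M. y / 2 \<le> t (\<lambda>k. Y k \<omega>)} \<le> sum g {J'..<L} * m / (y / 2)"
      unfolding t_def m_def using HT(3) inT g y
      by (intro prob_weighted_abs_sum_ge[OF int]) auto
    also have "sum g {J'..<L} * m \<le> d * m"
    proof (intro mult_right_mono m)
      show "sum g {J'..<L} \<le> d" using tail[of L] d by (cases "J \<le> L") (auto simp: J'_def)
    qed
    then have "sum g {J'..<L} * m / (y / 2) \<le> (y / 4) / (y / 2)"
      using d y by (intro divide_right_mono) auto
    finally have "prob {\<omega> \<in> space M. y / 2 \<le> t (\<lambda>k. Y k \<omega>)} \<le> 1 / 2" using y by simp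
    moreover have "prob {\<omega> \<in> space M. t (\<lambda>k. Y k \<omega>) < y / 2} = 1 - prob {\<omega> \<in> space M. y / 2 \<le> t (\<lambda>k. Y k \<omega>)}"
      using tM by (subst prob_neg[symmetric]) (auto simp: not_le)
    ultimately have half: "1 / 2 \<le> prob {\<omega> \<in> space M. t (\<lambda>k. Y k \<omega>) < y / 2}" by simp
    have "p ^ J / 2 \<le> p ^ J' * (1 / 2)" using p J' by (simp add: power_decreasing)
    also have "\<dots> \<le> p ^ J' * prob {\<omega> \<in> space M. t (\<lambda>k. Y k \<omega>) < y / 2}"
      using half p by (intro mult_left_mono) auto
    also have "\<dots> \<le> prob {\<omega> \<in> space M. \<not> block g L i \<omega> \<le> y / 2}"
      unfolding prod[symmetric]
    proof (intro finite_measure_mono subsetI)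
      fix \<omega> assume "\<omega> \<in> {\<omega> \<in> space M. (\<forall>k\<in>H. y < Y k \<omega>) \<and> t (\<lambda>k. Y k \<omega>) < y / 2}"
      then have \<omega>: "\<omega> \<in> space M" "\<And>k. k \<in> H \<Longrightarrow> y < Y k \<omega>" "t (\<lambda>k. Y k \<omega>) < y / 2" by auto
      have inH: "n - j \<in> H" if "j < J'" for j using that J' n by (auto simp: H_def)
      have "block g L i \<omega> = (\<Sum>j<L. g j * Y (n - j) \<omega>)" by (simp add: block_def n_def)
      also have "{..<L} = insert 0 {1..<J'} \<union> {J'..<L}" using J' by auto
      also have "(\<Sum>j\<in>insert 0 {1..<J'} \<union> {J'..<L}. g j * Y (n - j) \<omega>)
          = (\<Sum>j\<in>insert 0 {1..<J'}. g j * Y (n - j) \<omega>) + (\<Sum>j\<in>{J'..<L}. g j * Y (n - j) \<omega>)"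
        using J' by (intro sum.union_disjoint) auto
      also have "(\<Sum>j\<in>insert 0 {1..<J'}. g j * Y (n - j) \<omega>) = Y n \<omega> + (\<Sum>j\<in>{1..<J'}. g j * Y (n - j) \<omega>)"
        using g by simp
      finally have eq: "block g L i \<omega> = Y n \<omega> + (\<Sum>j\<in>{1..<J'}. g j * Y (n - j) \<omega>) + (\<Sum>j\<in>{J'..<L}. g j * Y (n - j) \<omega>)" .
      have "y < Y n \<omega>" using \<omega>(2)[OF inH[of 0]] J' by simp
      moreover have "0 \<le> (\<Sum>j\<in>{1..<J'}. g j * Y (n - j) \<omega>)"
      proof (intro sum_nonneg mult_nonneg_nonneg g)
        fix j assume "j \<in> {1..<J'}"
        then show "0 \<le> Y (n - j) \<omega>" using \<omega>(2)[OF inH[of j]] y by simp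
      qed
      moreover have "- t (\<lambda>k. Y k \<omega>) \<le> (\<Sum>j\<in>{J'..<L}. g j * Y (n - j) \<omega>)"
        unfolding t_def sum_negf[symmetric]
      proof (intro sum_mono)
        fix j
        have "g j * - \<bar>Y (n - j) \<omega>\<bar> \<le> g j * Y (n - j) \<omega>" using g(1) by (intro mult_left_mono) auto
        then show "- (g j * \<bar>Y (n - j) \<omega>\<bar>) \<le> g j * Y (n - j) \<omega>" by simp
      qed
      ultimately have "y / 2 < block g L i \<omega>" using \<omega>(3) eq by linarith
      then show "\<omega> \<in> {\<omega> \<in> space M. \<not> block g L i \<omega> \<le> y / 2}" using \<omega>(1) by simp
    qed measurable
    also have "\<dots> = 1 - prob {\<omega> \<in> space M. block g L i \<omega> \<le> y / 2}"
      by (rule prob_neg) measurable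
    finally show "prob {\<omega> \<in> space M. block g L i \<omega> \<le> y / 2} \<le> 1 - p ^ J / 2" by simp
  qed
qed

lemma concentration_less_one:
  assumes pos: "0 < prob {\<omega> \<in> space M. Y 1 \<omega> > 0}" "prob {\<omega> \<in> space M. Y 1 \<omega> > 0} < 1"
  obtains \<eta> \<theta> where "0 < \<eta>" "0 < \<theta>" "\<theta> < 1"
    "\<And>n a d. n \<ge> 1 \<Longrightarrow> 2 * d < \<eta> \<Longrightarrow> prob {\<omega> \<in> space M. \<bar>Y n \<omega> - a\<bar> \<le> d} \<le> \<theta>"
proof -
  obtain y where y: "0 < y" "0 < prob {\<omega> \<in> space M. Y 1 \<omega> > y}" using prob_gt_level[OF pos(1)] .
  have [measurable]: "Y 1 \<in> borel_measurable M" by (rule rv) simp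
  define \<theta> where "\<theta> = max (1 / 2) (max (prob {\<omega> \<in> space M. Y 1 \<omega> > 0}) (prob {\<omega> \<in> space M. Y 1 \<omega> \<le> y}))"
  have "prob {\<omega> \<in> space M. \<not> Y 1 \<omega> > y} = 1 - prob {\<omega> \<in> space M. Y 1 \<omega> > y}"
    by (rule prob_neg) measurable
  then have "prob {\<omega> \<in> space M. Y 1 \<omega> \<le> y} < 1" using y by (simp add: not_less)
  then have \<theta>: "0 < \<theta>" "\<theta> < 1" using pos by (auto simp: \<theta>_def)
  show thesis
  proof (rule that[OF y(1) \<theta>])
    fix n a d assume "n \<ge> (1::nat)" and d: "2 * d < y"
    have "prob {\<omega> \<in> space M. \<bar>Y n \<omega> - a\<bar> \<le> d} = prob {\<omega> \<in> space M. \<bar>Y 1 \<omega> - a\<bar> \<le> d}"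
      using prob_ident[OF \<open>n \<ge> 1\<close>, of "{x. \<bar>x - a\<bar> \<le> d}"] by simp
    also have "\<dots> \<le> \<theta>"
    proof (cases "a - d > 0")
      case True
      have "prob {\<omega> \<in> space M. \<bar>Y 1 \<omega> - a\<bar> \<le> d} \<le> prob {\<omega> \<in> space M. Y 1 \<omega> > 0}"
        using True by (intro finite_measure_mono) auto
      then show ?thesis by (simp add: \<theta>_def)
    next
      case False
      have "prob {\<omega> \<in> space M. \<bar>Y 1 \<omega> - a\<bar> \<le> d} \<le> prob {\<omega> \<in> space M. Y 1 \<omega> \<le> y}"
        using False d by (intro finite_measure_mono) auto
      then show ?thesis by (simp add: \<theta>_def)
    qed
    finally show "prob {\<omega> \<in> space M. \<bar>Y n \<omega> - a\<bar> \<le> d} \<le> \<theta>" .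
  qed
qed

lemma prob_block_concentration_le:
  assumes conc: "\<And>n a d. n \<ge> 1 \<Longrightarrow> 2 * d < \<eta> \<Longrightarrow> prob {\<omega> \<in> space M. \<bar>Y n \<omega> - a\<bar> \<le> d} \<le> \<theta>"
    and g: "g L \<noteq> 0" "2 * d < \<eta> * \<bar>g L\<bar>"
  shows "prob {\<omega> \<in> space M. \<bar>a + block g (Suc L) i \<omega>\<bar> \<le> d} \<le> \<theta>"
proof -
  define k where "k = Suc (i * Suc L)"
  define T where "T = {k<..Suc i * Suc L}"
  let ?S = "\<lambda>I. PiM I (\<lambda>_. borel :: real measure)"
  define t where "t u = (\<Sum>j<L. g j * (u (Suc i * Suc L - j) :: real))" for u
  have inT: "Suc i * Suc L - j \<in> T" if "j < L" for j
    using that by (auto simp: T_def k_def)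
  have ind: "indep_var (?S {k}) (\<lambda>\<omega>. restrict (\<lambda>k. Y k \<omega>) {k}) (?S T) (\<lambda>\<omega>. restrict (\<lambda>k. Y k \<omega>) T)"
    by (rule indep_var_restrict[OF indep]) (auto simp: T_def k_def)
  define B where "B = {z \<in> space (?S {k} \<Otimes>\<^sub>M ?S T). \<bar>a + g L * fst z k + t (snd z)\<bar> \<le> d}"
  have "t \<in> borel_measurable (?S T)"
    unfolding t_def
    by (intro borel_measurable_sum borel_measurable_times borel_measurable_const
        measurable_component_singleton inT) simp
  then have tm [measurable]: "(\<lambda>z. t (snd z)) \<in> borel_measurable (?S {k} \<Otimes>\<^sub>M ?S T)"
    by (rule measurable_compose[OF measurable_snd])
  have [measurable]: "(\<lambda>z. fst z k) \<in> borel_measurable (?S {k} \<Otimes>\<^sub>M ?S T)"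
    by (rule measurable_compose[OF measurable_fst measurable_component_singleton]) simp
  have B: "B \<in> sets (?S {k} \<Otimes>\<^sub>M ?S T)" unfolding B_def by measurable
  have tR: "t (restrict (\<lambda>k. Y k \<omega>) T) = t (\<lambda>k. Y k \<omega>)" for \<omega>
    unfolding t_def by (intro sum.cong refl) (simp only: restrict_apply' inT lessThan_iff)
  have "prob {\<omega> \<in> space M. (restrict (\<lambda>k. Y k \<omega>) {k}, restrict (\<lambda>k. Y k \<omega>) T) \<in> B
      \<and> restrict (\<lambda>k. Y k \<omega>) T \<in> space (?S T)}
      \<le> \<theta> * prob {\<omega> \<in> space M. restrict (\<lambda>k. Y k \<omega>) T \<in> space (?S T)}"
  proof (rule indep_var_prob_le[OF ind B sets.top])
    fix r assume r: "r \<in> space (?S T)"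
    have "{\<omega> \<in> space M. (restrict (\<lambda>k. Y k \<omega>) {k}, r) \<in> B}
        = {\<omega> \<in> space M. \<bar>Y k \<omega> - (- (a + t r) / g L)\<bar> \<le> d / \<bar>g L\<bar>}"
    proof (intro Collect_cong conj_cong refl)
      fix \<omega>
      have "a + g L * Y k \<omega> + t r = g L * (Y k \<omega> - (- (a + t r) / g L))"
        using g by (simp add: field_simps)
      then have "\<bar>a + g L * Y k \<omega> + t r\<bar> = \<bar>g L\<bar> * \<bar>Y k \<omega> - (- (a + t r) / g L)\<bar>"
        by (simp only: abs_mult)
      then show "(restrict (\<lambda>k. Y k \<omega>) {k}, r) \<in> B \<longleftrightarrow> \<bar>Y k \<omega> - (- (a + t r) / g L)\<bar> \<le> d / \<bar>g L\<bar>"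
        using r g by (simp add: B_def space_pair_measure space_PiM le_divide_eq mult.commute)
    qed
    also have "prob \<dots> \<le> \<theta>"
      using g by (intro conc) (auto simp: k_def field_simps)
    finally show "prob {\<omega> \<in> space M. (restrict (\<lambda>k. Y k \<omega>) {k}, r) \<in> B} \<le> \<theta>" .
  qed
  moreover have "block g (Suc L) i \<omega> = t (\<lambda>k. Y k \<omega>) + g L * Y k \<omega>" for \<omega>
    by (simp add: block_def t_def k_def)
  then have "(restrict (\<lambda>k. Y k \<omega>) {k}, restrict (\<lambda>k. Y k \<omega>) T) \<in> B \<longleftrightarrow> \<bar>a + block g (Suc L) i \<omega>\<bar> \<le> d" for \<omega>
    unfolding B_def by (simp add: tR space_pair_measure space_PiM algebra_simps)
  ultimately show ?thesis by (simp add: space_PiM prob_space)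
qed

lemma prob_large_innovation_le:
  assumes int: "integrable M (\<lambda>\<omega>. exp (\<bar>Y 1 \<omega>\<bar> powr \<alpha>))" and "\<alpha> > 0" "K \<ge> 0"
  shows "prob {\<omega> \<in> space M. \<exists>i\<in>{1..N}. \<bar>Y i \<omega>\<bar> > K}
    \<le> expectation (\<lambda>\<omega>. exp (\<bar>Y 1 \<omega>\<bar> powr \<alpha>)) * real N * exp (- (K powr \<alpha>))"
proof -
  let ?E = "expectation (\<lambda>\<omega>. exp (\<bar>Y 1 \<omega>\<bar> powr \<alpha>))"
  have one: "prob {\<omega> \<in> space M. \<bar>Y i \<omega>\<bar> > K} \<le> ?E * exp (- (K powr \<alpha>))" if "i \<in> {1..N}" for i
  proof -
    have [measurable]: "Y 1 \<in> borel_measurable M" by (rule rv) simp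
    have "prob {\<omega> \<in> space M. \<bar>Y i \<omega>\<bar> > K} = prob {\<omega> \<in> space M. \<bar>Y 1 \<omega>\<bar> > K}"
      using prob_ident[of i "{x. \<bar>x\<bar> > K}"] that by simp
    also have "\<dots> \<le> prob {\<omega> \<in> space M. exp (K powr \<alpha>) \<le> exp (\<bar>Y 1 \<omega>\<bar> powr \<alpha>)}"
      using \<open>\<alpha> > 0\<close> \<open>K \<ge> 0\<close> by (intro finite_measure_mono) (auto intro!: powr_mono2)
    also have "\<dots> \<le> ?E / exp (K powr \<alpha>)"
      by (intro integral_Markov_inequality_measure[OF int, where A = "{}"]) auto
    finally show ?thesis by (simp add: exp_minus field_simps)
  qed
  have "{\<omega> \<in> space M. \<exists>i\<in>{1..N}. \<bar>Y i \<omega>\<bar> > K} = (\<Union>i\<in>{1..N}. {\<omega> \<in> space M. \<bar>Y i \<omega>\<bar> > K})" by auto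
  then have "prob {\<omega> \<in> space M. \<exists>i\<in>{1..N}. \<bar>Y i \<omega>\<bar> > K} \<le> (\<Sum>i\<in>{1..N}. prob {\<omega> \<in> space M. \<bar>Y i \<omega>\<bar> > K})"
    using rv by (auto intro!: finite_measure_subadditive_finite)
  also have "\<dots> \<le> (\<Sum>i\<in>{1..N}. ?E * exp (- (K powr \<alpha>)))" by (intro sum_mono one)
  finally show ?thesis by (simp add: mult_ac)
qed

lemma integrable_if_exp_moment:
  assumes int: "integrable M (\<lambda>\<omega>. exp (\<bar>Y 1 \<omega>\<bar> powr \<alpha>))" and "\<alpha> > 0"
  shows "integrable M (Y 1)"
proof (rule Bochner_Integration.integrable_bound)
  let ?c = "(1 + \<bar>ln \<alpha>\<bar>) / \<alpha>"
  show "integrable M (\<lambda>\<omega>. exp ?c * exp (\<bar>Y 1 \<omega>\<bar> powr \<alpha>))" using int by simp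
  show "Y 1 \<in> borel_measurable M" by (rule rv) simp
  have "\<bar>x\<bar> \<le> exp ?c * exp (\<bar>x\<bar> powr \<alpha>)" for x :: real
  proof (cases "x = 0")
    case False
    then have x: "0 < \<bar>x\<bar>" by simp
    have "ln (\<alpha> * \<bar>x\<bar> powr \<alpha>) \<le> \<alpha> * \<bar>x\<bar> powr \<alpha> - 1"
      using x \<open>\<alpha> > 0\<close> by (intro ln_le_minus_one) simp
    then have "\<alpha> * ln \<bar>x\<bar> \<le> \<alpha> * \<bar>x\<bar> powr \<alpha> + (1 + \<bar>ln \<alpha>\<bar>)"
      using x \<open>\<alpha> > 0\<close> by (simp add: ln_mult ln_powr)
    moreover have "\<alpha> * ?c = 1 + \<bar>ln \<alpha>\<bar>" using \<open>\<alpha> > 0\<close> by simp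
    ultimately have "\<alpha> * ln \<bar>x\<bar> \<le> \<alpha> * (?c + \<bar>x\<bar> powr \<alpha>)" unfolding distrib_left by linarith
    then have "ln \<bar>x\<bar> \<le> ?c + \<bar>x\<bar> powr \<alpha>" using \<open>\<alpha> > 0\<close> by simp
    then have "exp (ln \<bar>x\<bar>) \<le> exp (?c + \<bar>x\<bar> powr \<alpha>)" by simp
    then show ?thesis using x by (simp add: exp_add)
  qed simp
  then show "AE \<omega> in M. norm (Y 1 \<omega>) \<le> norm (exp ?c * exp (\<bar>Y 1 \<omega>\<bar> powr \<alpha>))"
    by simp
qed

subsection \<open>Persistence probabilities\<close>

lemma ar2_measurable: "ar2 a1 a2 Y n \<in> borel_measurable M"
proof -
  have "(\<lambda>\<omega>. \<Sum>j<n. impulse a1 a2 j * Y (n - j) \<omega>) \<in> borel_measurable M"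
    by (intro borel_measurable_sum borel_measurable_times borel_measurable_const rv) auto
  then show ?thesis by (simp add: ar2_moving_average[abs_def])
qed

lemma persist_prob_le:
  assumes int: "integrable M (\<lambda>\<omega>. exp (\<bar>Y 1 \<omega>\<bar> powr \<alpha>))" and "\<alpha> > 0" and S: "S \<in> events"
    and cover: "\<And>\<omega>. \<omega> \<in> space M \<Longrightarrow> (\<And>n. n \<le> N \<Longrightarrow> ar2 a1 a2 Y n \<omega> \<le> 0) \<Longrightarrow>
      (\<And>i. i \<in> {1..N} \<Longrightarrow> \<bar>Y i \<omega>\<bar> \<le> real N powr (1 / \<alpha>)) \<Longrightarrow> \<omega> \<in> S"
  shows "persist_prob M a1 a2 Y N
    \<le> expectation (\<lambda>\<omega>. exp (\<bar>Y 1 \<omega>\<bar> powr \<alpha>)) * real N * exp (- real N) + prob S"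
proof -
  let ?B = "{\<omega> \<in> space M. \<exists>i\<in>{1..N}. \<bar>Y i \<omega>\<bar> > real N powr (1 / \<alpha>)}"
  have "?B = (\<Union>i\<in>{1..N}. {\<omega> \<in> space M. \<bar>Y i \<omega>\<bar> > real N powr (1 / \<alpha>)})" by auto
  then have B: "?B \<in> events" using rv by auto
  have "persist_prob M a1 a2 Y N \<le> prob (?B \<union> S)"
    unfolding persist_prob_def
  proof (intro finite_measure_mono subsetI)
    fix \<omega> assume \<omega>: "\<omega> \<in> {\<omega> \<in> space M. \<forall>n\<in>{1..N}. ar2 a1 a2 Y n \<omega> \<le> 0}"
    have "ar2 a1 a2 Y n \<omega> \<le> 0" if "n \<le> N" for n
      using \<omega> that by (cases "n = 0") auto
    then show "\<omega> \<in> ?B \<union> S"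
      using cover[of \<omega>] \<omega> by (force simp: not_less)
  qed (use B S in auto)
  also have "\<dots> \<le> prob ?B + prob S" using B S by (rule measure_Un_le)
  also have "prob ?B \<le> expectation (\<lambda>\<omega>. exp (\<bar>Y 1 \<omega>\<bar> powr \<alpha>)) * real N * exp (- ((real N powr (1 / \<alpha>)) powr \<alpha>))"
    by (rule prob_large_innovation_le[OF int \<open>\<alpha> > 0\<close>]) simp
  also have "(real N powr (1 / \<alpha>)) powr \<alpha> = real N"
    using \<open>\<alpha> > 0\<close> by (cases "N = 0") (simp_all add: powr_powr)
  finally show ?thesis by simp
qed

lemma persist_prob_bigo_impulse_nonpos:
  assumes int: "integrable M (Y 1)" and pos: "0 < prob {\<omega> \<in> space M. Y 1 \<omega> > 0}"
    and a2: "a2 \<le> 0" and ex: "\<exists>k\<ge>1. impulse a1 a2 k \<le> 0"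
  shows "\<exists>l>0. persist_prob M a1 a2 Y \<in> O(\<lambda>N. exp (- l * real N / ln (real N)))"
proof -
  define k where "k = (LEAST k. impulse a1 a2 (Suc k) \<le> 0)"
  have "\<exists>k. impulse a1 a2 (Suc k) \<le> 0" using ex Suc_le_D by fastforce
  then have k: "impulse a1 a2 (Suc k) \<le> 0" unfolding k_def by (rule LeastI_ex)
  have h: "0 < impulse a1 a2 j" if "j \<le> k" for j
  proof (cases j)
    case (Suc i)
    then show ?thesis using not_less_Least[of i "\<lambda>k. impulse a1 a2 (Suc k) \<le> 0"] that by (simp add: k_def)
  qed simp
  define g where "g j = (if j < Suc k then impulse a1 a2 j else 0)" for j
  have "0 \<le> g j" for j using h[of j] by (auto simp: g_def)
  moreover have "g 0 = 1" by (simp add: g_def)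
  moreover have "summable g"
    by (rule summable_finite[of "{..<Suc k}"]) (auto simp: g_def)
  ultimately obtain e \<theta> where e: "0 < e" "0 < \<theta>" "\<theta> < 1"
    and block: "\<And>L i. L \<ge> 1 \<Longrightarrow> prob {\<omega> \<in> space M. block g L i \<omega> \<le> e} \<le> \<theta>"
    using prob_block_le[OF int pos] by blast
  define L where "L = k + 2"
  have "\<forall>\<^sub>F N in sequentially. ln (real N) \<ge> real L" by real_asymp
  then have "\<forall>\<^sub>F N in sequentially. persist_prob M a1 a2 Y N
      \<le> 0 * real N * exp (- real N) + \<theta> ^ nat \<lfloor>1 * real N / nat \<lceil>1 * ln (real N)\<rceil>\<rfloor>"
  proof eventually_elim
    case (elim N)
    define m where "m = nat \<lfloor>real N / nat \<lceil>ln (real N)\<rceil>\<rfloor>"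
    have L: "1 \<le> L" "L \<le> nat \<lceil>ln (real N)\<rceil>" using elim by (simp_all add: L_def) linarith
    have "persist_prob M a1 a2 Y N \<le> prob {\<omega> \<in> space M. \<forall>i<m. block g L i \<omega> \<le> e}"
      unfolding persist_prob_def
    proof (intro finite_measure_mono subsetI)
      fix \<omega> assume \<omega>: "\<omega> \<in> {\<omega> \<in> space M. \<forall>n\<in>{1..N}. ar2 a1 a2 Y n \<omega> \<le> 0}"
      have X: "ar2 a1 a2 Y n \<omega> \<le> 0" if "n \<le> N" for n
        using \<omega> that by (cases "n = 0") auto
      have "block g L i \<omega> \<le> e" if "i < m" for i
      proof -
        have "real (Suc i * nat \<lceil>ln (real N)\<rceil>) \<le> real N"
          using that L unfolding m_def by (intro mult_le_of_less_nat_floor_divide) linarith+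
        then have "Suc i * nat \<lceil>ln (real N)\<rceil> \<le> N" by (simp only: of_nat_le_iff)
        moreover have "Suc i * L \<le> Suc i * nat \<lceil>ln (real N)\<rceil>" using L by (intro mult_le_mono2)
        moreover have SL: "Suc i * L = i * L + k + 2" by (simp add: L_def)
        ultimately have le: "i * L + k + 2 \<le> N" by linarith
        have "block g L i \<omega> = (\<Sum>j<Suc (Suc k). g j * Y (i * L + k + 2 - j) \<omega>)"
          unfolding block_def SL by (simp add: L_def)
        also have "\<dots> = (\<Sum>j<Suc k. g j * Y (i * L + k + 2 - j) \<omega>)"
          by (subst sum.lessThan_Suc) (simp add: g_def)
        also have "\<dots> = (\<Sum>j<Suc k. impulse a1 a2 j * Y (i * L + k + 2 - j) \<omega>)"
          by (intro sum.cong) (auto simp: g_def)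
        finally have "block g L i \<omega> = ar2 a1 a2 Y (i * L + k + 2) \<omega>
            - impulse a1 a2 (Suc k) * ar2 a1 a2 Y (Suc (i * L)) \<omega> - a2 * impulse a1 a2 k * ar2 a1 a2 Y (i * L) \<omega>"
          using ar2_unroll[of a1 a2 Y "i * L" k \<omega>] by linarith
        moreover have "0 \<le> impulse a1 a2 (Suc k) * ar2 a1 a2 Y (Suc (i * L)) \<omega>"
          using k X[of "Suc (i * L)"] le by (intro mult_nonpos_nonpos) auto
        moreover have "0 \<le> a2 * impulse a1 a2 k * ar2 a1 a2 Y (i * L) \<omega>"
          using a2 h[of k] X[of "i * L"] le by (intro mult_nonpos_nonpos mult_nonpos_nonneg) auto
        ultimately show ?thesis using X[OF le] e(1) by linarith
      qed
      then show "\<omega> \<in> {\<omega> \<in> space M. \<forall>i<m. block g L i \<omega> \<le> e}" using \<omega> by simp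
    qed measurable
    also have "\<dots> \<le> \<theta> ^ m" using block[OF L(1)] e by (intro prob_blocks_le) auto
    finally show ?case by (simp add: m_def)
  qed
  then show ?thesis
    using e by (intro stretched_exponential_bigo[of \<theta> 1 1 0]) (auto simp: persist_prob_def)
qed

lemma persist_prob_bigo_stable_nonneg_roots:
  assumes int: "integrable M (\<lambda>\<omega>. exp (\<bar>Y 1 \<omega>\<bar> powr \<alpha>))" and "\<alpha> > 0"
    and pos: "0 < prob {\<omega> \<in> space M. Y 1 \<omega> > 0}"
    and s: "0 \<le> s1" "s1 < 1" "0 \<le> s2" "s2 < 1"
  shows "\<exists>l>0. persist_prob M (s1 + s2) (- (s1 * s2)) Y \<in> O(\<lambda>N. exp (- l * real N / ln (real N)))"
proof -
  let ?h = "impulse (s1 + s2) (- (s1 * s2))"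
  define r where "r = (1 + max s1 s2) / 2"
  have r: "0 < r" "r < 1" "s1 \<le> r" "s2 < r" using s by (auto simp: r_def)
  define C where "C = r / (r - s2)"
  have C: "0 < C" using r by (simp add: C_def)
  have h: "0 \<le> ?h j" "?h j \<le> C * r ^ j" for j
    unfolding C_def by (rule impulse_geometric_bound[OF s(1,3) r(3,4)])+
  have "summable (\<lambda>j. C * r ^ j)" using r by (intro summable_mult summable_geometric) auto
  then have "summable ?h"
    by (rule summable_comparison_test') (use h in simp)
  moreover have "?h 0 = 1" by simp
  ultimately obtain e \<theta> where e: "0 < e" "0 < \<theta>" "\<theta> < 1"
    and block: "\<And>L i. L \<ge> 1 \<Longrightarrow> prob {\<omega> \<in> space M. block ?h L i \<omega> \<le> e} \<le> \<theta>"
    using prob_block_le[where g = ?h, OF integrable_if_exp_moment[OF int \<open>\<alpha> > 0\<close>] pos h(1)] by blast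
  define b where "b = (1 / \<alpha> + 1) / (- ln r)"
  have "ln r < 0" using r by simp
  then have b: "0 < b" "b * ln r = - (1 / \<alpha>) - 1"
    using \<open>\<alpha> > 0\<close> by (auto simp: b_def intro!: divide_pos_neg add_pos_pos)
  let ?E = "expectation (\<lambda>\<omega>. exp (\<bar>Y 1 \<omega>\<bar> powr \<alpha>))"
  have "\<forall>\<^sub>F N in sequentially. real N \<ge> C / (1 - r) / e" by real_asymp
  moreover have "\<forall>\<^sub>F N in sequentially. ln (real N) \<ge> 1" by real_asymp
  ultimately have "\<forall>\<^sub>F N in sequentially. persist_prob M (s1 + s2) (- (s1 * s2)) Y N
      \<le> ?E * real N * exp (- real N) + \<theta> ^ nat \<lfloor>1 * real N / nat \<lceil>b * ln (real N)\<rceil>\<rfloor>"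
  proof eventually_elim
    case (elim N)
    define K where "K = real N powr (1 / \<alpha>)"
    define L where "L = nat \<lceil>b * ln (real N)\<rceil>"
    define m where "m = nat \<lfloor>real N / L\<rfloor>"
    have N: "1 \<le> real N" using elim(2) by (cases "N = 0") auto
    have "0 < b * ln (real N)" using b elim(2) by (intro mult_pos_pos) auto
    then have L: "1 \<le> L" unfolding L_def by linarith
    have "K * r ^ L \<le> K * real N powr (b * ln r)"
      unfolding L_def using r N b by (intro mult_left_mono power_nat_ceiling_ln) (auto simp: K_def)
    also have "\<dots> = real N powr (- 1)"
      unfolding K_def b(2) by (simp flip: powr_add)
    also have "\<dots> = 1 / real N" using N by (simp add: powr_minus_divide)
    finally have "K * r ^ L * (C / (1 - r)) \<le> 1 / real N * (C / (1 - r))"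
      using C r by (intro mult_right_mono) auto
    also have "\<dots> \<le> 1 / real N * (real N * e)"
      using elim(1) e(1) by (intro mult_left_mono) (simp_all only: pos_divide_le_eq[OF e(1)], simp)
    also have "\<dots> = e" using N by simp
    finally have KL: "K * r ^ L * (C / (1 - r)) \<le> e" .
    have "persist_prob M (s1 + s2) (- (s1 * s2)) Y N
        \<le> ?E * real N * exp (- real N) + prob {\<omega> \<in> space M. \<forall>i<m. block ?h L i \<omega> \<le> e}"
    proof (rule persist_prob_le[OF int \<open>\<alpha> > 0\<close>])
      fix \<omega> assume \<omega>: "\<omega> \<in> space M"
        and X: "\<And>n. n \<le> N \<Longrightarrow> ar2 (s1 + s2) (- (s1 * s2)) Y n \<omega> \<le> 0"
        and Y: "\<And>i. i \<in> {1..N} \<Longrightarrow> \<bar>Y i \<omega>\<bar> \<le> real N powr (1 / \<alpha>)"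
      have "block ?h L i \<omega> \<le> e" if "i < m" for i
      proof -
        define n where "n = Suc i * L"
        have "real n \<le> real N"
          using that L unfolding m_def n_def by (intro mult_le_of_less_nat_floor_divide) auto
        then have n: "n \<le> N" by simp
        have Ln: "L \<le> n" by (simp add: n_def)
        have "(\<Sum>j<n. ?h j * Y (n - j) \<omega>) = block ?h L i \<omega> + (\<Sum>j\<in>{L..<n}. ?h j * Y (n - j) \<omega>)"
          unfolding block_def n_def[symmetric]
          using Ln by (simp add: lessThan_atLeast0 sum.atLeastLessThan_concat)
        then have "block ?h L i \<omega> \<le> - (\<Sum>j\<in>{L..<n}. ?h j * Y (n - j) \<omega>)"
          using X[OF n] by (simp add: ar2_moving_average)
        also have "\<dots> \<le> (\<Sum>j\<in>{L..<n}. K * C * r ^ j)"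
          unfolding sum_negf[symmetric]
        proof (intro sum_mono)
          fix j assume j: "j \<in> {L..<n}"
          then have "\<bar>Y (n - j) \<omega>\<bar> \<le> K" unfolding K_def using n by (intro Y) auto
          then have "?h j * - Y (n - j) \<omega> \<le> ?h j * K" using h(1) by (intro mult_left_mono) auto
          also have "\<dots> \<le> C * r ^ j * K" using h(2) by (intro mult_right_mono) (auto simp: K_def)
          finally show "- (?h j * Y (n - j) \<omega>) \<le> K * C * r ^ j" by (simp add: mult_ac)
        qed
        also have "\<dots> = K * C * (\<Sum>j\<in>{L..<n}. r ^ j)" by (simp add: sum_distrib_left)
        also have "\<dots> \<le> K * C * (r ^ L / (1 - r))"
          using r C by (intro mult_left_mono sum_power_tail_le) (auto simp: K_def)
        also have "\<dots> \<le> e" using KL by (simp add: mult_ac)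
        finally show ?thesis .
      qed
      then show "\<omega> \<in> {\<omega> \<in> space M. \<forall>i<m. block ?h L i \<omega> \<le> e}" using \<omega> by simp
    qed measurable
    also have "prob {\<omega> \<in> space M. \<forall>i<m. block ?h L i \<omega> \<le> e} \<le> \<theta> ^ m"
      using block[OF L] e by (intro prob_blocks_le) auto
    finally show ?case by (simp add: m_def L_def)
  qed
  moreover have "0 \<le> ?E" by (intro Bochner_Integration.integral_nonneg) simp
  ultimately show ?thesis
    using e b by (intro stretched_exponential_bigo[of \<theta> 1 b ?E]) (auto simp: persist_prob_def)
qed

lemma persist_prob_le_ar1:
  assumes "s2 \<le> 0"
  shows "persist_prob M (s1 + s2) (- (s1 * s2)) Y N \<le> persist_prob M s1 0 Y N"
  unfolding persist_prob_def
proof (intro finite_measure_mono subsetI)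
  fix \<omega> assume \<omega>: "\<omega> \<in> {\<omega> \<in> space M. \<forall>n\<in>{1..N}. ar2 (s1 + s2) (- (s1 * s2)) Y n \<omega> \<le> 0}"
  then have X: "ar2 (s1 + s2) (- (s1 * s2)) Y n \<omega> \<le> 0" if "n \<le> N" for n
    using that by (cases "n = 0") auto
  have "ar2 s1 0 Y n \<omega> \<le> 0" if n: "n \<in> {1..N}" for n
  proof -
    obtain k where k: "n = Suc k" using n by (cases n) auto
    have "0 \<le> s2 * ar2 (s1 + s2) (- (s1 * s2)) Y k \<omega>"
      using assms X[of k] n k by (intro mult_nonpos_nonpos) auto
    then show ?thesis using X[of n] n ar2_factor[of s1 Y k \<omega> s2] unfolding k by simp
  qed
  then show "\<omega> \<in> {\<omega> \<in> space M. \<forall>n\<in>{1..N}. ar2 s1 0 Y n \<omega> \<le> 0}" using \<omega> by simp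
next
  have [measurable]: "ar2 s1 0 Y n \<in> borel_measurable M" for n by (rule ar2_measurable)
  show "{\<omega> \<in> space M. \<forall>n\<in>{1..N}. ar2 s1 0 Y n \<omega> \<le> 0} \<in> events" by measurable
qed

lemma ar1_block_sum:
  "(\<Sum>j<i. (c ^ L) ^ (i - 1 - j) * block (\<lambda>j. c ^ j) L j \<omega>) = ar2 c 0 Y (i * L) \<omega>"
proof (induction i)
  case (Suc i)
  have "(\<Sum>j<Suc i. (c ^ L) ^ (Suc i - 1 - j) * block (\<lambda>j. c ^ j) L j \<omega>)
      = (\<Sum>j<i. c ^ L * ((c ^ L) ^ (i - 1 - j) * block (\<lambda>j. c ^ j) L j \<omega>)) + block (\<lambda>j. c ^ j) L i \<omega>"
  proof -
    have "(c ^ L) ^ (Suc i - 1 - j) = c ^ L * (c ^ L) ^ (i - 1 - j)" if "j < i" for j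
      using that by (simp flip: power_Suc add: Suc_diff_Suc)
    then show ?thesis by (simp add: mult.assoc)
  qed
  also have "\<dots> = c ^ L * ar2 c 0 Y (i * L) \<omega> + block (\<lambda>j. c ^ j) L i \<omega>"
    unfolding sum_distrib_left[symmetric] Suc ..
  also have "\<dots> = ar2 c 0 Y (i * L + L) \<omega>"
    unfolding ar1_unroll block_def by (simp add: add.commute)
  finally show ?case by (simp add: add.commute)
qed simp

text \<open>For the roots \<open>s\<close> and \<open>- t\<close>, the AR(1) processes \<open>Z = X\<^sub>n + t X\<^sub>n\<^sub>-\<^sub>1\<close> with coefficient \<open>s\<close> and
  \<open>D = X\<^sub>n - s X\<^sub>n\<^sub>-\<^sub>1\<close> with coefficient \<open>- t\<close> satisfy \<open>\<bar>D\<bar> \<le> \<bar>Z\<bar>\<close> as long as \<open>X \<le> 0\<close>. At time \<open>N\<close> this only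
  gives \<open>\<bar>D\<bar> \<lesssim> s ^ N\<close>, but the recursion of \<open>D\<close> contracts by \<open>1 / t\<close> when read backwards.\<close>
lemma persist_imp_unstable_part_bounded:
  assumes st: "1 \<le> s" "s < t"
    and X: "\<And>n. n \<le> N \<Longrightarrow> ar2 (s - t) (s * t) Y n \<omega> \<le> 0"
    and Y: "\<And>i. i \<in> {1..N} \<Longrightarrow> \<bar>Y i \<omega>\<bar> \<le> K"
    and K: "0 \<le> K" and n: "n \<le> N" "s ^ N * t ^ n \<le> t ^ N"
  shows "\<bar>ar2 (- t) 0 Y n \<omega>\<bar> \<le> K * (real N + 1 / (t - 1))"
proof (cases "N = 0")
  case True
  then show ?thesis using n st K by simp
next
  case False
  then obtain k where k: "N = Suc k" by (cases N) auto
  have t: "1 < t" using st by simp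
  let ?X = "ar2 (s - t) (s * t) Y" and ?D = "ar2 (- t) 0 Y" and ?Z = "ar2 s 0 Y"
  have Z: "?Z N \<omega> = ?X N \<omega> + t * ?X k \<omega>"
    using ar2_factor[of s Y k \<omega> "- t"] by (simp add: k)
  have D: "?D N \<omega> = ?X N \<omega> - s * ?X k \<omega>"
    using ar2_factor[of "- t" Y k \<omega> s] by (simp add: k mult.commute)
  have "s * - ?X k \<omega> \<le> t * - ?X k \<omega>" "0 \<le> s * - ?X k \<omega>"
    using X[of k] st k by (intro mult_right_mono mult_nonneg_nonneg; simp)+
  then have "\<bar>?D N \<omega>\<bar> \<le> \<bar>?Z N \<omega>\<bar>"
    unfolding D Z using X[of N] by auto
  also have "\<bar>?Z N \<omega>\<bar> \<le> (\<Sum>j<N. \<bar>s ^ j * Y (N - j) \<omega>\<bar>)"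
    unfolding ar1_moving_average by (rule sum_abs)
  also have "\<dots> \<le> (\<Sum>j<N. s ^ N * K)"
  proof (intro sum_mono)
    fix j assume "j \<in> {..<N}"
    then show "\<bar>s ^ j * Y (N - j) \<omega>\<bar> \<le> s ^ N * K"
      unfolding abs_mult using st Y[of "N - j"] by (intro mult_mono) (auto intro: power_increasing)
  qed
  finally have DN: "\<bar>?D N \<omega>\<bar> \<le> real N * s ^ N * K" by simp
  define L where "L = N - n"
  have N: "N = n + L" using n by (simp add: L_def)
  define R where "R = (\<Sum>j<L. (- t) ^ j * Y (n + L - j) \<omega>)"
  have "\<bar>R\<bar> \<le> (\<Sum>j<L. \<bar>(- t) ^ j * Y (n + L - j) \<omega>\<bar>)"
    unfolding R_def by (rule sum_abs)
  also have "\<dots> \<le> (\<Sum>j<L. t ^ j * K)"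
    using Y N t by (intro sum_mono) (auto simp: abs_mult power_abs intro!: mult_left_mono)
  also have "\<dots> = (t ^ L - 1) / (t - 1) * K"
    using t by (simp add: geometric_sum flip: sum_distrib_right)
  also have "\<dots> \<le> t ^ L / (t - 1) * K"
    using t K by (intro mult_right_mono divide_right_mono) auto
  finally have R: "\<bar>R\<bar> \<le> t ^ L * (K / (t - 1))" by simp
  have sN: "s ^ N \<le> t ^ L"
  proof -
    have "s ^ N * t ^ n \<le> t ^ L * t ^ n" using n(2) by (simp add: N power_add mult_ac)
    then show ?thesis using t by simp
  qed
  have "(- t) ^ L * ?D n \<omega> = ?D N \<omega> - R"
    unfolding N ar1_unroll R_def by simp
  then have "t ^ L * \<bar>?D n \<omega>\<bar> = \<bar>?D N \<omega> - R\<bar>"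
    using t by (metis abs_mult power_abs abs_minus_cancel abs_of_pos less_trans zero_less_one)
  also have "\<dots> \<le> real N * s ^ N * K + t ^ L * (K / (t - 1))" using DN R by linarith
  also have "real N * s ^ N * K \<le> real N * t ^ L * K"
    using sN K by (intro mult_right_mono mult_left_mono) auto
  finally have "t ^ L * \<bar>?D n \<omega>\<bar> \<le> t ^ L * (K * (real N + 1 / (t - 1)))"
    by (simp add: algebra_simps)
  then show ?thesis using t by simp
qed

lemma persist_prob_bigo_dominant_negative_root:
  assumes int: "integrable M (\<lambda>\<omega>. exp (\<bar>Y 1 \<omega>\<bar> powr \<alpha>))" and "\<alpha> > 0"
    and pos: "0 < prob {\<omega> \<in> space M. Y 1 \<omega> > 0}" "prob {\<omega> \<in> space M. Y 1 \<omega> > 0} < 1"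
    and st: "1 \<le> s" "s < t"
  shows "\<exists>l>0. persist_prob M (s - t) (s * t) Y \<in> O(\<lambda>N. exp (- l * real N / ln (real N)))"
proof -
  obtain \<eta> \<theta> where \<eta>: "0 < \<eta>" "0 < \<theta>" "\<theta> < 1"
    and conc: "\<And>n a d. n \<ge> 1 \<Longrightarrow> 2 * d < \<eta> \<Longrightarrow> prob {\<omega> \<in> space M. \<bar>Y n \<omega> - a\<bar> \<le> d} \<le> \<theta>"
    using concentration_less_one[OF pos] by blast
  have t: "1 < t" "0 < ln t" using st by auto
  define c where "c = 1 - ln s / ln t"
  have c: "0 < c" "c \<le> 1" using st t by (auto simp: c_def)
  define b where "b = (1 / \<alpha> + 2) / ln t"
  have b: "0 < b" "b * ln t = 1 / \<alpha> + 2" using t \<open>\<alpha> > 0\<close> by (auto simp: b_def add_pos_pos)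
  define q where "q = 1 / (t - 1)"
  define g where "g = (\<lambda>j. (- t) ^ j)"
  let ?E = "expectation (\<lambda>\<omega>. exp (\<bar>Y 1 \<omega>\<bar> powr \<alpha>))"
  have "\<forall>\<^sub>F N in sequentially. 2 * t * (real N + q) < \<eta> * real N ^ 2"
    using \<eta>(1) by real_asymp
  moreover have "\<forall>\<^sub>F N in sequentially. ln (real N) \<ge> 1" by real_asymp
  ultimately have "\<forall>\<^sub>F N in sequentially. persist_prob M (s - t) (s * t) Y N
      \<le> ?E * real N * exp (- real N) + \<theta> ^ nat \<lfloor>c * real N / nat \<lceil>b * ln (real N)\<rceil>\<rfloor>"
  proof eventually_elim
    case (elim N)
    define K where "K = real N powr (1 / \<alpha>)"
    define d where "d = K * (real N + q)"
    define L where "L = nat \<lceil>b * ln (real N)\<rceil>"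
    define m where "m = nat \<lfloor>c * real N / L\<rfloor>"
    have N: "1 \<le> real N" using elim(2) by (cases "N = 0") auto
    have "0 < b * ln (real N)" using b elim(2) by (intro mult_pos_pos) auto
    then have L: "1 \<le> L" unfolding L_def by linarith
    then obtain L' where L': "L = Suc L'" by (cases L) auto
    have "K * real N ^ 2 = real N powr (b * ln t)"
      using N unfolding K_def b(2) by (simp add: powr_add powr_numeral)
    also have "\<dots> \<le> t ^ L"
      unfolding L_def using t N b by (intro power_nat_ceiling_ln) auto
    finally have KL: "K * real N ^ 2 \<le> t ^ L" .
    have "t * (2 * d) = K * (2 * t * (real N + q))" by (simp add: d_def)
    also have "\<dots> < K * (\<eta> * real N ^ 2)"
      using elim(1) N by (intro mult_strict_left_mono) (auto simp: K_def)
    also have "\<dots> \<le> \<eta> * t ^ L" using KL \<eta> by (simp add: mult.left_commute)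
    also have "\<dots> = t * (\<eta> * \<bar>g L'\<bar>)" using t by (simp add: L' g_def power_abs)
    finally have d: "2 * d < \<eta> * \<bar>g L'\<bar>" using t by simp
    let ?W = "\<lambda>i \<omega>. \<Sum>j<i. ((- t) ^ L) ^ (i - 1 - j) * block g L j \<omega>"
    define B where "B = {z :: real \<times> real. \<bar>(- t) ^ L * fst z + snd z\<bar> \<le> d}"
    have "closed B"
      unfolding B_def by (intro closed_Collect_le continuous_intros)
    then have B: "B \<in> sets (borel \<Otimes>\<^sub>M borel)"
      unfolding borel_prod by (rule borel_closed)
    have W: "?W i \<omega> = ar2 (- t) 0 Y (i * L) \<omega>" for i \<omega>
      unfolding g_def by (rule ar1_block_sum)
    have Wm: "?W i \<in> borel_measurable M" for i
      by measurable
    have "{\<omega> \<in> space M. \<forall>i\<in>{..<m}. (?W i \<omega>, block g L i \<omega>) \<in> B} \<in> events"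
    proof (intro sets.sets_Collect_finite_All)
      fix i
      have "(\<lambda>\<omega>. (?W i \<omega>, block g L i \<omega>)) \<in> measurable M (borel \<Otimes>\<^sub>M borel)"
        by (intro measurable_Pair Wm block_measurable)
      from measurable_sets[OF this B] show "{\<omega> \<in> space M. (?W i \<omega>, block g L i \<omega>) \<in> B} \<in> events"
        by (simp add: vimage_def Int_def conj_commute)
    qed simp
    then have S: "{\<omega> \<in> space M. \<forall>i<m. (?W i \<omega>, block g L i \<omega>) \<in> B} \<in> events"
      unfolding Ball_def lessThan_iff .
    have "persist_prob M (s - t) (s * t) Y N
        \<le> ?E * real N * exp (- real N) + prob {\<omega> \<in> space M. \<forall>i<m. (?W i \<omega>, block g L i \<omega>) \<in> B}"
    proof (rule persist_prob_le[OF int \<open>\<alpha> > 0\<close> S])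
      fix \<omega> assume \<omega>: "\<omega> \<in> space M"
        and X: "\<And>n. n \<le> N \<Longrightarrow> ar2 (s - t) (s * t) Y n \<omega> \<le> 0"
        and Y: "\<And>i. i \<in> {1..N} \<Longrightarrow> \<bar>Y i \<omega>\<bar> \<le> real N powr (1 / \<alpha>)"
      have "(?W i \<omega>, block g L i \<omega>) \<in> B" if "i < m" for i
      proof -
        define n where "n = Suc i * L"
        have cN: "real n \<le> c * real N"
          using that L unfolding m_def n_def by (intro mult_le_of_less_nat_floor_divide) auto
        also have "\<dots> \<le> real N" using c by (simp add: mult_left_le_one_le)
        finally have n: "n \<le> N" by simp
        have "real N * ln s + real n * ln t \<le> real N * ln t"
          using mult_right_mono[OF cN, of "ln t"] t by (simp add: c_def algebra_simps)
        then have "exp (real N * ln s + real n * ln t) \<le> exp (real N * ln t)" by simp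
        then have "s ^ N * t ^ n \<le> t ^ N" using st t by (simp add: exp_add exp_of_nat_mult)
        from persist_imp_unstable_part_bounded[OF st X Y _ n this]
        have "\<bar>ar2 (- t) 0 Y n \<omega>\<bar> \<le> d" by (simp add: d_def K_def q_def)
        moreover have "ar2 (- t) 0 Y n \<omega> = (- t) ^ L * ?W i \<omega> + block g L i \<omega>"
        proof -
          have nL: "n = i * L + L" by (simp add: n_def)
          have "block g L i \<omega> = (\<Sum>j<L. (- t) ^ j * Y (i * L + L - j) \<omega>)"
            by (simp add: block_def g_def add.commute)
          then show ?thesis unfolding W nL ar1_unroll by simp
        qed
        ultimately show ?thesis by (simp add: B_def)
      qed
      then show "\<omega> \<in> {\<omega> \<in> space M. \<forall>i<m. (?W i \<omega>, block g L i \<omega>) \<in> B}" using \<omega> by simp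
    qed
    also have "prob {\<omega> \<in> space M. \<forall>i<m. (?W i \<omega>, block g L i \<omega>) \<in> B} \<le> \<theta> ^ m"
    proof (rule indep_vars_chain_prob_le[OF indep_blocks B])
      fix i w
      have "prob {\<omega> \<in> space M. \<bar>(- t) ^ L * w + block g (Suc L') i \<omega>\<bar> \<le> d} \<le> \<theta>"
        using d t by (intro prob_block_concentration_le[OF conc]) (auto simp: g_def)
      then show "prob {\<omega> \<in> space M. (w, block g L i \<omega>) \<in> B} \<le> \<theta>" by (simp add: B_def L')
    qed (use \<eta> in simp)
    finally show ?case by (simp add: m_def L_def)
  qed
  moreover have "0 \<le> ?E" by (intro Bochner_Integration.integral_nonneg) simp
  ultimately show ?thesis
    using \<eta> b c by (intro stretched_exponential_bigo[of \<theta> c b ?E]) (auto simp: persist_prob_def)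
qed

end

theorem theorem1p2:
  fixes M :: "'a measure" and Y :: "nat \<Rightarrow> 'a \<Rightarrow> real" and a1 a2 \<alpha> :: real
  assumes "prob_space M"
    and "(a1, a2) \<in> region_E"
    and rv: "\<And>n. n \<ge> 1 \<Longrightarrow> Y n \<in> borel_measurable M"
    and indep: "prob_space.indep_vars M (\<lambda>_. borel) Y {1..}"
    and ident: "\<And>n. n \<ge> 1 \<Longrightarrow> distr M borel (Y n) = distr M borel (Y 1)"
    and pos: "0 < measure M {\<omega> \<in> space M. Y 1 \<omega> > 0}"
             "measure M {\<omega> \<in> space M. Y 1 \<omega> > 0} < 1"
    and "\<alpha> > 0"
    and "integrable M (\<lambda>\<omega>. exp (\<bar>Y 1 \<omega>\<bar> powr \<alpha>))"
    and "((\<lambda>t. char (distr M borel (Y 1)) t) \<longlongrightarrow> 0) at_infinity"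
  shows "\<exists>l>0. (\<lambda>N. persist_prob M a1 a2 Y N) \<in> O(\<lambda>N. exp (- l * real N / ln (real N)))"
proof -
  interpret prob_space M by fact
  interpret iid_reals M Y by unfold_locales (fact indep, fact ident)
  note moment = \<open>integrable M (\<lambda>\<omega>. exp (\<bar>Y 1 \<omega>\<bar> powr \<alpha>))\<close>
  note int = integrable_if_exp_moment[OF moment \<open>\<alpha> > 0\<close>]
  have C: "(a1, a2) \<notin> region_C" and P: "(a1, a2) \<notin> region_P"
    using assms(2) by (auto simp: region_E_def)
  have ?thesis if "a2 \<le> 0" "\<exists>k\<ge>1. impulse a1 a2 k \<le> 0"
    using persist_prob_bigo_impulse_nonpos[OF int pos(1) that] .
  moreover have ?thesis if a2: "a2 \<le> 0" and h: "\<not> (\<exists>k\<ge>1. impulse a1 a2 k \<le> 0)"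
  proof -
    have "a1\<^sup>2 + 4 * a2 \<ge> 0" using impulse_nonpos_if_complex_roots[of a1 a2] h not_le by blast
    then obtain s1 s2 where s: "a1 = s1 + s2" "a2 = - (s1 * s2)" "s2 \<le> s1" by (rule quadratic_factor)
    have disc: "a1\<^sup>2 + 4 * a2 = (s1 - s2)\<^sup>2" by (simp add: s power2_eq_square algebra_simps)
    have "a1 > 0" using h by (auto simp: not_le dest!: spec[of _ 1])
    then have s1: "0 < s1" using s by linarith
    have "0 \<le> s1 * s2" using a2 s by simp
    then have s2: "0 \<le> s2" using s1 by (simp add: zero_le_mult_iff)
    have "s1 < 1"
    proof (rule ccontr)
      assume "\<not> s1 < 1"
      then have s11: "1 \<le> s1" by simp
      show False
      proof (cases "s1 = s2")
        case True
        then have "a1\<^sup>2 + 4 * a2 = 0" using disc by simp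
        moreover have "a1 > 2 \<or> (a1 = 2 \<and> a2 = - 1)" using True s s11 by auto
        ultimately show False using C P by (auto simp: region_C_def region_P_def)
      next
        case False
        then have pd: "a1\<^sup>2 + 4 * a2 > 0" using disc by simp
        then have "a1 < 2" using C by (auto simp: region_C_def)
        then have "s2 < 1" using s s11 by simp
        have "a1 + a2 - 1 = (s1 - 1) * (1 - s2)" by (simp add: s algebra_simps)
        moreover have "0 \<le> (s1 - 1) * (1 - s2)" using s11 \<open>s2 < 1\<close> by simp
        ultimately have "a1 + a2 \<ge> 1" by linarith
        then have "a1 + a2 = 1" using C \<open>a1 > 0\<close> \<open>a1 < 2\<close> by (auto simp: region_C_def)
        then show False using P \<open>a1 > 0\<close> \<open>a1 < 2\<close> by (auto simp: region_P_def)
      qed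
    qed
    then show ?thesis
      using persist_prob_bigo_stable_nonneg_roots[OF moment \<open>\<alpha> > 0\<close> pos(1), of s1 s2] s s1 s2 by simp
  qed
  moreover have ?thesis if a2: "a2 > 0"
  proof -
    have "a1\<^sup>2 + 4 * a2 \<ge> 0" using a2 by simp
    then obtain s1 s2 where s: "a1 = s1 + s2" "a2 = - (s1 * s2)" "s2 \<le> s1" by (rule quadratic_factor)
    have "s1 * s2 < 0" using a2 s by simp
    then have s12: "s2 < 0" "0 < s1" using s(3) by (auto simp: mult_less_0_iff)
    show ?thesis
    proof (cases "s1 < 1")
      case True
      obtain l where l: "l > 0" "persist_prob M s1 0 Y \<in> O(\<lambda>N. exp (- l * real N / ln (real N)))"
        using persist_prob_bigo_stable_nonneg_roots[OF moment \<open>\<alpha> > 0\<close> pos(1), of s1 0] True s12 by auto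
      have "(\<lambda>N. persist_prob M a1 a2 Y N) \<in> O(persist_prob M s1 0 Y)"
        using persist_prob_le_ar1[of s2 s1] s12
        by (intro landau_o.big_mono always_eventually) (simp add: s persist_prob_def)
      then show ?thesis using l landau_o.big.trans by blast
    next
      case False
      have "a1 + a2 - 1 = (s1 - 1) * (1 - s2)" by (simp add: s algebra_simps)
      moreover have "0 \<le> (s1 - 1) * (1 - s2)" using False s12 by simp
      ultimately have ge: "a1 + a2 \<ge> 1" by linarith
      have "a1 < 0"
      proof (rule ccontr)
        assume "\<not> a1 < 0"
        then have "a1 \<ge> 0" by simp
        moreover have "a1\<^sup>2 + 4 * a2 > 0" using a2 by (simp add: add_nonneg_pos)
        ultimately show False using C P ge a2
          by (cases "a1 = 0"; cases "a1 \<ge> 2"; cases "a1 + a2 = 1") (auto simp: region_C_def region_P_def)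
      qed
      then have "s1 < - s2" using s by simp
      then show ?thesis
        using persist_prob_bigo_dominant_negative_root[OF moment \<open>\<alpha> > 0\<close> pos, of s1 "- s2"] False s by simp
    qed
  qed
  ultimately show ?thesis by (cases "a2 \<le> 0") auto
qed

end
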